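(* Let $n\in\mathbb{N}$, $n\ge1$, and let $G \in \mathcal{S}_{od}(\mathbb{R}^{2n})$. Then for all $s \in \mathbb{R}$, $$\operatorname{div}_{s} G \in \mathcal{S}(\mathbb{R}^n),$$ where the $s$-divergence is defined, for all $x \in \mathbb{R}^n$, by $$\operatorname{div}_{s} G(x) := \int_{\mathbb{R}^n} \frac{2G(x,y)}{|x-y|^{s}} \frac{dy}{| x-y |^n} = \int_{\mathbb{R}^n} \frac{G(x,y) - G(y,x)}{|x-y|^{s}} \frac{dy}{| x-y |^n}.$$ In addition, for every $s\in\mathbb{R}$, the map $G \mapsto \operatorname{div}_{s} G$ from $\mathcal{S}_{od}(\mathbb{R}^{2n})$ to $\mathcal{S}(\mathbb{R}^n)$ is continuous.
   Context: $\mathcal{S}(\mathbb{R}^m)$ is the space of complex-valued Schwartz functions on $\mathbb{R}^m$ with its usual Fréchet topology given by the Schwartz seminorms. $\mathcal{S}_{od}(\mathbb{R}^{2n})$ (off-diagonal Schwartz functions) is the set of $G \in \mathcal{S}(\mathbb{R}^{2n})$, $G = G(x,y)$ with $x,y\in\mathbb{R}^n$, such that $G(x,y) = -G(y,x)$ for all $x,y$ and $\partial_x^{\alpha}\partial_y^{\beta} G(z,z) = 0$ for all $z \in \mathbb{R}^n$ and all multi-indices $\alpha,\beta \in \mathbb{N}_0^n$; it carries the subspace topology of $\mathcal{S}(\mathbb{R}^{2n})$. *)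

theory Defs
  imports "HOL-Analysis.Analysis"
begin

text \<open>
  The Euclidean space of dimension \<open>m\<close> is an arbitrary type of class \<open>euclidean_space\<close>, so that
  everything applies both to \<open>real ^ 'n\<close> and to \<open>(real ^ 'n) \<times> (real ^ 'n)\<close>, the
  latter playing the role of the space of dimension \<open>2n\<close>. A multi-index is a function into \<open>nat\<close>
  of which only the values on \<open>Basis\<close> matter.
\<close>

definition partial_deriv ::
    "'a::euclidean_space \<Rightarrow> ('a \<Rightarrow> complex) \<Rightarrow> 'a \<Rightarrow> complex" where
  "partial_deriv b f x = vector_derivative (\<lambda>t. f (x + t *\<^sub>R b)) (at 0)"

text \<open>
  \<open>Basis\<close> carries no order, so an enumeration is fixed once and for all. For smooth functions
  partial derivatives commute and the choice is immaterial.
\<close>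

definition basis_list :: "'a::euclidean_space list" where
  "basis_list = (SOME bs. distinct bs \<and> set bs = Basis)"

lemma basis_list: "distinct (basis_list :: 'a::euclidean_space list)"
    "set (basis_list :: 'a list) = Basis"
proof -
  have "\<exists>bs :: 'a list. distinct bs \<and> set bs = Basis"
    using finite_distinct_list[OF finite_Basis] by blast
  from someI_ex[OF this]
  show "distinct (basis_list :: 'a list)" "set (basis_list :: 'a list) = Basis"
    by (simp_all add: basis_list_def)
qed

definition multi_deriv ::
    "('a::euclidean_space \<Rightarrow> nat) \<Rightarrow> ('a \<Rightarrow> complex) \<Rightarrow> 'a \<Rightarrow> complex" where
  "multi_deriv \<alpha> f = foldr (\<lambda>b. partial_deriv b ^^ \<alpha> b) basis_list f"

definition monomial :: "('a::euclidean_space \<Rightarrow> nat) \<Rightarrow> 'a \<Rightarrow> real" where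
  "monomial \<alpha> x = (\<Prod>b\<in>Basis. (x \<bullet> b) ^ \<alpha> b)"

primrec C_k :: "nat \<Rightarrow> ('a::euclidean_space \<Rightarrow> complex) \<Rightarrow> bool" where
  "C_k 0 f \<longleftrightarrow> continuous_on UNIV f"
| "C_k (Suc k) f \<longleftrightarrow>
    (\<forall>x. f differentiable (at x)) \<and> (\<forall>b\<in>Basis. C_k k (partial_deriv b f))"

definition smooth :: "('a::euclidean_space \<Rightarrow> complex) \<Rightarrow> bool" where
  "smooth f \<longleftrightarrow> (\<forall>k. C_k k f)"

definition schwartz_space :: "('a::euclidean_space \<Rightarrow> complex) set" where
  "schwartz_space = {f. smooth f \<and>
    (\<forall>\<alpha> \<beta>. bdd_above (range (\<lambda>x. norm (monomial \<alpha> x *\<^sub>R multi_deriv \<beta> f x))))}"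

definition schwartz_seminorm ::
    "('a::euclidean_space \<Rightarrow> nat) \<Rightarrow> ('a \<Rightarrow> nat) \<Rightarrow> ('a \<Rightarrow> complex) \<Rightarrow> real" where
  "schwartz_seminorm \<alpha> \<beta> f = (SUP x. norm (monomial \<alpha> x *\<^sub>R multi_deriv \<beta> f x))"

text \<open>
  The locally convex topology defined by the seminorms: the open seminorm balls around
  all points form a subbase.
\<close>

definition schwartz_topology :: "('a::euclidean_space \<Rightarrow> complex) topology" where
  "schwartz_topology = topology_generated_by
    {{f \<in> schwartz_space. schwartz_seminorm \<alpha> \<beta> (\<lambda>x. f x - g x) < \<epsilon>} | \<alpha> \<beta> g \<epsilon>.
      g \<in> schwartz_space \<and> \<epsilon> > 0}"

definition schwartz_od :: "((real ^ 'n) \<times> (real ^ 'n) \<Rightarrow> complex) set" where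
  "schwartz_od = {G \<in> schwartz_space.
    (\<forall>x y. G (x, y) = - G (y, x)) \<and>
    (\<forall>\<alpha> \<beta> z. multi_deriv \<alpha> (\<lambda>x. multi_deriv \<beta> (\<lambda>y. G (x, y)) z) z = 0)}"

definition schwartz_od_topology :: "((real ^ 'n) \<times> (real ^ 'n) \<Rightarrow> complex) topology" where
  "schwartz_od_topology = subtopology schwartz_topology schwartz_od"

text \<open>
  At \<open>y = x\<close> the integrand takes the junk value \<open>0\<close>; this concerns a null set only. The
  Bochner integral is \<open>0\<close> for non-integrable functions, so integrability of
  \<open>div_integrand s G x\<close> has to be stated separately.
\<close>

definition div_integrand ::
    "real \<Rightarrow> ((real ^ 'n) \<times> (real ^ 'n) \<Rightarrow> complex) \<Rightarrow> real ^ 'n \<Rightarrow> real ^ 'n \<Rightarrow> complex" where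
  "div_integrand s G x y =
    2 * G (x, y) / complex_of_real (norm (x - y) powr s)
      * complex_of_real (1 / norm (x - y) ^ CARD('n))"

definition s_div ::
    "real \<Rightarrow> ((real ^ 'n) \<times> (real ^ 'n) \<Rightarrow> complex) \<Rightarrow> real ^ 'n \<Rightarrow> complex" where
  "s_div s G x = (LINT y|lborel. div_integrand s G x y)"

lemma topspace_schwartz_topology:
  "topspace (schwartz_topology :: ('a::euclidean_space \<Rightarrow> complex) topology) = schwartz_space"
proof -
  have pd: "partial_deriv b (\<lambda>_. 0) = (\<lambda>_. 0)" for b :: 'a
    by (rule ext) (simp add: partial_deriv_def)
  have pow: "(partial_deriv b ^^ k) (\<lambda>_. 0) = (\<lambda>_. 0)" for b :: 'a and k
    by (induction k) (simp_all add: pd)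
  have "foldr (\<lambda>b. partial_deriv b ^^ \<alpha> b) bs (\<lambda>_. 0) = (\<lambda>_. 0)" for \<alpha> and bs :: "'a list"
    by (induction bs) (simp_all add: pow)
  then have zero: "schwartz_seminorm \<alpha> \<beta> (\<lambda>_. 0) = 0" for \<alpha> \<beta> :: "'a \<Rightarrow> nat"
    by (simp add: schwartz_seminorm_def multi_deriv_def)
  show ?thesis
  proof
    show "topspace schwartz_topology \<subseteq> (schwartz_space :: ('a \<Rightarrow> complex) set)"
      by (auto simp: schwartz_topology_def)
    show "(schwartz_space :: ('a \<Rightarrow> complex) set) \<subseteq> topspace schwartz_topology"
    proof
      fix f :: "'a \<Rightarrow> complex" assume f: "f \<in> schwartz_space"
      let ?B = "{h \<in> schwartz_space. schwartz_seminorm (\<lambda>_. 0) (\<lambda>_. 0) (\<lambda>x. h x - f x) < 1}"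
      have "f \<in> ?B"
        using f zero by simp
      moreover have "openin schwartz_topology ?B"
        unfolding schwartz_topology_def
        by (rule topology_generated_by_Basis) (use f zero_less_one in blast)
      ultimately show "f \<in> topspace schwartz_topology"
        using openin_subset by blast
    qed
  qed
qed

end

theory Submission
  imports Defs
begin

text \<open>
  Let \<open>n\<close> be the dimension of the space and \<open>a = -(s + n)\<close>. Substituting \<open>y = x + h\<close>, the
  \<open>s\<close>-divergence of \<open>G\<close> at \<open>x\<close> is \<open>2 I G x\<close>, where \<open>I G x\<close> is the integral over \<open>h\<close> of
  \<open>norm h powr a\<close> times \<open>G (x, x + h)\<close>. Everything rests on two observations.

  First, if all derivatives of \<open>G\<close> vanish on the diagonal, then \<open>G (x, x + h)\<close> is smaller than any
  power of \<open>norm h\<close> as \<open>h\<close> tends to \<open>0\<close>, and like any Schwartz function it decays faster than any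
  power of \<open>x\<close> and \<open>h\<close>. So for each \<open>k\<close> the integrand times \<open>(1 + norm x) ^ k\<close> is
  at most \<open>q G / (1 + norm h) ^ (n + 2)\<close>, where the constant \<open>q G\<close> is bounded by finitely many
  Schwartz seminorms of \<open>G\<close> (\<open>controlled_kernel_bound\<close>). This proves integrability and weighted
  bounds for \<open>I G\<close>.

  Second, differentiating \<open>G (x, x + h)\<close> in \<open>x\<close> produces the derivative \<open>D\<^sub>b G\<close> of \<open>G\<close> in the
  direction \<open>(b, b)\<close>, at the same point. Since \<open>D\<^sub>b G\<close> is again a Schwartz function whose
  derivatives all vanish on the diagonal, \<open>\<partial>\<^sub>b (I G) = I (D\<^sub>b G)\<close>
  (\<open>partial_deriv_diag_integral\<close>): the first-order Taylor remainder is dominated by second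
  derivatives, to which the kernel bound applies. By iteration \<open>I G\<close> is smooth and each of its Schwartz
  seminorms is bounded by finitely many seminorms of \<open>G\<close>
  (\<open>controlled_seminorm_diag_integral\<close>). Since \<open>I\<close> is linear, this means
  continuity (\<open>continuous_map_schwartz\<close>).

  Because the seminorms take partial derivatives in one fixed order, the symmetry of
  mixed derivatives (\<open>partial_deriv_commute\<close>) is needed to compare them with derivatives
  taken in any other order.
\<close>

section \<open>Partial derivatives\<close>

lemma partial_deriv_eq:
  assumes "(f has_derivative D) (at x)"
  shows "partial_deriv b f x = D b"
proof -
  have "((\<lambda>t. f (x + t *\<^sub>R b)) has_derivative (\<lambda>t. D (t *\<^sub>R b))) (at 0)"
    by (rule has_derivative_compose[where f = "\<lambda>t. x + t *\<^sub>R b" and g = f])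
      (use assms in \<open>auto intro!: derivative_eq_intros\<close>)
  moreover have "D (t *\<^sub>R b) = t *\<^sub>R D b" for t
    using assms by (simp add: has_derivative_def bounded_linear.linear linear_scale)
  ultimately show ?thesis
    unfolding partial_deriv_def
    by (intro vector_derivative_at) (simp add: has_vector_derivative_def)
qed

lemma has_derivative_partials:
  assumes "f differentiable (at x)"
  shows "(f has_derivative (\<lambda>v. \<Sum>b\<in>Basis. (v \<bullet> b) *\<^sub>R partial_deriv b f x)) (at x)"
proof -
  obtain D where D: "(f has_derivative D) (at x)"
    using assms by (auto simp: differentiable_def)
  then have lin: "linear D"
    by (simp add: has_derivative_def bounded_linear.linear)
  have "D v = (\<Sum>b\<in>Basis. (v \<bullet> b) *\<^sub>R partial_deriv b f x)" for v
  proof -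
    have "D v = D (\<Sum>b\<in>Basis. (v \<bullet> b) *\<^sub>R b)"
      by (simp add: euclidean_representation)
    also have "\<dots> = (\<Sum>b\<in>Basis. (v \<bullet> b) *\<^sub>R D b)"
      by (simp add: linear_sum[OF lin] linear_scale[OF lin])
    finally show ?thesis
      by (simp add: partial_deriv_eq[OF D])
  qed
  then have "D = (\<lambda>v. \<Sum>b\<in>Basis. (v \<bullet> b) *\<^sub>R partial_deriv b f x)"
    by blast
  with D show ?thesis
    by simp
qed

lemma has_vector_derivative_along_line:
  assumes "f differentiable (at (x + t *\<^sub>R b))"
  shows "((\<lambda>t. f (x + t *\<^sub>R b)) has_vector_derivative partial_deriv b f (x + t *\<^sub>R b)) (at t within T)"
proof -
  obtain D where D: "(f has_derivative D) (at (x + t *\<^sub>R b))"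
    using assms by (auto simp: differentiable_def)
  have "((\<lambda>t. f (x + t *\<^sub>R b)) has_derivative (\<lambda>u. D (u *\<^sub>R b))) (at t within T)"
    by (rule has_derivative_compose[where f = "\<lambda>t. x + t *\<^sub>R b" and g = f])
      (use D in \<open>auto intro!: derivative_eq_intros\<close>)
  moreover have "D (u *\<^sub>R b) = u *\<^sub>R partial_deriv b f (x + t *\<^sub>R b)" for u
    using D by (simp add: has_derivative_def bounded_linear.linear linear_scale partial_deriv_eq[OF D])
  ultimately show ?thesis
    by (simp add: has_vector_derivative_def)
qed

lemma partial_deriv_add:
  assumes "f differentiable (at x)" "g differentiable (at x)"
  shows "partial_deriv b (\<lambda>x. f x + g x) x = partial_deriv b f x + partial_deriv b g x"
proof -
  obtain D E where D: "(f has_derivative D) (at x)" and E: "(g has_derivative E) (at x)"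
    using assms by (auto simp: differentiable_def)
  show ?thesis
    by (simp add: partial_deriv_eq[OF D] partial_deriv_eq[OF E]
        partial_deriv_eq[OF has_derivative_add[OF D E]])
qed

lemma partial_deriv_diff:
  assumes "f differentiable (at x)" "g differentiable (at x)"
  shows "partial_deriv b (\<lambda>x. f x - g x) x = partial_deriv b f x - partial_deriv b g x"
proof -
  obtain D E where D: "(f has_derivative D) (at x)" and E: "(g has_derivative E) (at x)"
    using assms by (auto simp: differentiable_def)
  show ?thesis
    by (simp add: partial_deriv_eq[OF D] partial_deriv_eq[OF E]
        partial_deriv_eq[OF has_derivative_diff[OF D E]])
qed

lemma onorm_partials_le:
  fixes c :: "'a::euclidean_space \<Rightarrow> 'b::real_normed_vector"
  assumes "\<And>b. b \<in> Basis \<Longrightarrow> norm (c b) \<le> B b"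
  shows "onorm (\<lambda>v. \<Sum>b\<in>Basis. (v \<bullet> b) *\<^sub>R c b) \<le> (\<Sum>b\<in>Basis. B b)"
proof (rule onorm_le)
  fix v :: 'a
  have "norm (\<Sum>b\<in>Basis. (v \<bullet> b) *\<^sub>R c b) \<le> (\<Sum>b\<in>Basis. B b * norm v)"
  proof (rule sum_norm_le)
    fix b :: 'a assume b: "b \<in> Basis"
    have "\<bar>v \<bullet> b\<bar> * norm (c b) \<le> norm v * B b"
      by (intro mult_mono) (use Basis_le_norm[OF b] assms[OF b] in auto)
    then show "norm ((v \<bullet> b) *\<^sub>R c b) \<le> B b * norm v"
      by (simp add: mult.commute)
  qed
  then show "norm (\<Sum>b\<in>Basis. (v \<bullet> b) *\<^sub>R c b) \<le> (\<Sum>b\<in>Basis. B b) * norm v"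
    by (simp add: sum_distrib_right)
qed

lemma mean_value_partials:
  fixes f :: "'a::euclidean_space \<Rightarrow> complex"
  assumes diff: "\<And>y. f differentiable (at y)"
    and B: "\<And>t b. \<lbrakk>0 \<le> t; t \<le> 1; b \<in> Basis\<rbrakk> \<Longrightarrow> norm (partial_deriv b f (x + t *\<^sub>R v)) \<le> B b"
  shows "norm (f (x + v) - f x) \<le> norm v * (\<Sum>b\<in>Basis. B b)"
proof -
  let ?S = "closed_segment x (x + v)"
  have "norm (f (x + v) - f x) \<le> (\<Sum>b\<in>Basis. B b) * norm (x + v - x)"
  proof (rule differentiable_bound[where S = ?S])
    show "(f has_derivative (\<lambda>w. \<Sum>b\<in>Basis. (w \<bullet> b) *\<^sub>R partial_deriv b f y)) (at y within ?S)" for y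
      by (rule has_derivative_at_withinI[OF has_derivative_partials[OF diff]])
    fix y assume "y \<in> ?S"
    then obtain t where t: "0 \<le> t" "t \<le> 1" "y = (1 - t) *\<^sub>R x + t *\<^sub>R (x + v)"
      by (auto simp: closed_segment_def)
    then have y: "y = x + t *\<^sub>R v"
      by (simp add: algebra_simps)
    show "onorm (\<lambda>w. \<Sum>b\<in>Basis. (w \<bullet> b) *\<^sub>R partial_deriv b f y) \<le> (\<Sum>b\<in>Basis. B b)"
      using B[OF t(1,2)] unfolding y by (rule onorm_partials_le)
  qed auto
  then show ?thesis
    by (simp add: mult.commute)
qed

text \<open>
  The remainder is controlled by second partial derivatives on all of space, with no limit
  involved. Applied under an integral sign it therefore gives differentiability of the integral
  at once, without a dominated convergence argument.
\<close>

lemma taylor_partials: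
  fixes f :: "'a::euclidean_space \<Rightarrow> complex"
  assumes diff: "\<And>y. f differentiable (at y)"
    and diff2: "\<And>b y. b \<in> Basis \<Longrightarrow> partial_deriv b f differentiable (at y)"
    and B: "\<And>b c y. \<lbrakk>b \<in> Basis; c \<in> Basis\<rbrakk> \<Longrightarrow> norm (partial_deriv c (partial_deriv b f) y) \<le> B"
  shows "norm (f (x + v) - f x - (\<Sum>b\<in>Basis. (v \<bullet> b) *\<^sub>R partial_deriv b f x))
    \<le> (norm v)\<^sup>2 * ((real DIM('a))\<^sup>2 * B)"
proof -
  let ?S = "closed_segment x (x + v)"
  let ?D = "\<lambda>y w. \<Sum>b\<in>Basis. (w \<bullet> b) *\<^sub>R partial_deriv b f y"
  have B0: "B \<ge> 0"
  proof -
    obtain b :: 'a where "b \<in> Basis"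
      using nonempty_Basis by blast
    from B[OF this this, of x] show ?thesis
      using norm_ge_zero order_trans by blast
  qed
  have "norm (f (x + v) - f x - ?D x (x + v - x))
      \<le> norm (x + v - x) * (\<Sum>b\<in>(Basis::'a set). norm v * (real DIM('a) * B))"
  proof (rule differentiable_bound_linearization[where S = ?S])
    show "(f has_derivative ?D y) (at y within ?S)" for y
      by (rule has_derivative_at_withinI[OF has_derivative_partials[OF diff]])
    show "x + t *\<^sub>R (x + v - x) \<in> ?S" if "t \<in> {0..1}" for t
      using that by (auto simp: closed_segment_def algebra_simps intro!: exI[of _ t])
    fix y assume "y \<in> ?S"
    then obtain t where t: "0 \<le> t" "t \<le> 1" "y = (1 - t) *\<^sub>R x + t *\<^sub>R (x + v)"
      by (auto simp: closed_segment_def)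
    then have y: "y = x + t *\<^sub>R v"
      by (simp add: algebra_simps)
    have *: "norm (partial_deriv b f y - partial_deriv b f x) \<le> norm v * (real DIM('a) * B)"
      if b: "b \<in> Basis" for b
    proof -
      have "norm (partial_deriv b f (x + t *\<^sub>R v) - partial_deriv b f x)
          \<le> norm (t *\<^sub>R v) * (\<Sum>c\<in>(Basis::'a set). B)"
        by (rule mean_value_partials) (use diff2 B b in auto)
      also have "\<dots> \<le> norm v * (\<Sum>c\<in>(Basis::'a set). B)"
        by (intro mult_right_mono) (use t B0 in \<open>auto simp: mult_left_le_one_le\<close>)
      finally show ?thesis
        by (simp add: y)
    qed
    have "?D y - ?D x = (\<lambda>w. \<Sum>b\<in>Basis. (w \<bullet> b) *\<^sub>R (partial_deriv b f y - partial_deriv b f x))"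
      by (auto simp: fun_eq_iff scaleR_diff_right sum_subtractf)
    then show "onorm (?D y - ?D x) \<le> (\<Sum>b\<in>(Basis::'a set). norm v * (real DIM('a) * B))"
      using onorm_partials_le[of "\<lambda>b. partial_deriv b f y - partial_deriv b f x"
          "\<lambda>b. norm v * (real DIM('a) * B)"] * by simp
  qed auto
  then show ?thesis
    by (simp add: power2_eq_square ac_simps)
qed

text \<open>
  The second difference of \<open>f\<close> over the parallelogram with sides \<open>\<delta> b\<close> and \<open>\<delta> c\<close> is
  \<open>\<delta>\<^sup>2\<close> times \<open>\<partial>\<^sub>c \<partial>\<^sub>b f\<close>, up to the oscillation of that derivative. The second difference is
  symmetric in \<open>b\<close> and \<open>c\<close>, which makes this the key to the symmetry of mixed derivatives.
\<close>

lemma mixed_difference_bound: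
  fixes f :: "'a::euclidean_space \<Rightarrow> complex"
  assumes diff: "\<And>y. f differentiable (at y)"
    and diff_b: "\<And>y. partial_deriv b f differentiable (at y)"
    and near: "\<And>u w. \<lbrakk>0 \<le> u; u \<le> \<delta>; 0 \<le> w; w \<le> \<delta>\<rbrakk> \<Longrightarrow>
      norm (partial_deriv c (partial_deriv b f) (x + u *\<^sub>R b + w *\<^sub>R c) - L) \<le> \<epsilon>"
    and \<delta>: "\<delta> \<ge> 0"
  shows "norm (f (x + \<delta> *\<^sub>R b + \<delta> *\<^sub>R c) - f (x + \<delta> *\<^sub>R b) - f (x + \<delta> *\<^sub>R c) + f x - \<delta>\<^sup>2 *\<^sub>R L)
    \<le> \<delta>\<^sup>2 * \<epsilon>"
proof -
  \<comment> \<open>Mean value inequality twice: for \<open>g\<close> in the direction \<open>b\<close>, and for its derivative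
    \<open>g'\<close>, a difference of values of \<open>\<partial>\<^sub>b f\<close>, in the direction \<open>c\<close>.\<close>
  define g where "g u = f (x + \<delta> *\<^sub>R c + u *\<^sub>R b) - f (x + u *\<^sub>R b) - (u * \<delta>) *\<^sub>R L" for u
  define g' where "g' u = partial_deriv b f (x + \<delta> *\<^sub>R c + u *\<^sub>R b) - partial_deriv b f (x + u *\<^sub>R b) - \<delta> *\<^sub>R L" for u
  have onorm: "onorm (\<lambda>h. h *\<^sub>R z) \<le> B" if "norm z \<le> B" for z :: complex and B :: real
    by (rule onorm_le) (use that mult_right_mono[OF that abs_ge_zero] in \<open>simp add: mult.commute\<close>)
  have g: "(g has_vector_derivative g' u) (at u within {0..\<delta>})" for u
    unfolding g_def g'_def
    by (intro has_vector_derivative_diff has_vector_derivative_along_line diff)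
      (auto intro!: derivative_eq_intros simp: has_vector_derivative_def)
  have "norm (g' u) \<le> \<delta> * \<epsilon>" if u: "u \<in> {0..\<delta>}" for u
  proof -
    define k where "k w = partial_deriv b f (x + u *\<^sub>R b + w *\<^sub>R c) - w *\<^sub>R L" for w
    have "norm (k \<delta> - k 0) \<le> \<epsilon> * norm (\<delta> - 0)"
    proof (rule differentiable_bound[where S = "{0..\<delta>}"])
      fix w assume w: "w \<in> {0..\<delta>}"
      have "(k has_vector_derivative partial_deriv c (partial_deriv b f) (x + u *\<^sub>R b + w *\<^sub>R c) - L)
          (at w within {0..\<delta>})"
        unfolding k_def
        by (intro has_vector_derivative_diff has_vector_derivative_along_line diff_b)
          (auto intro!: derivative_eq_intros simp: has_vector_derivative_def)
      then show "(k has_derivative (\<lambda>h. h *\<^sub>R (partial_deriv c (partial_deriv b f)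
          (x + u *\<^sub>R b + w *\<^sub>R c) - L))) (at w within {0..\<delta>})"
        by (simp add: has_vector_derivative_def)
      show "onorm (\<lambda>h. h *\<^sub>R (partial_deriv c (partial_deriv b f) (x + u *\<^sub>R b + w *\<^sub>R c) - L)) \<le> \<epsilon>"
        by (rule onorm) (use near u w in auto)
    qed (use \<delta> in auto)
    moreover have "k \<delta> - k 0 = g' u"
      by (simp add: k_def g'_def algebra_simps)
    ultimately show ?thesis
      using \<delta> by (simp add: mult.commute)
  qed
  then have "norm (g \<delta> - g 0) \<le> (\<delta> * \<epsilon>) * norm (\<delta> - 0)"
    by (intro differentiable_bound[where S = "{0..\<delta>}" and f' = "\<lambda>u h. h *\<^sub>R g' u"])
      (use \<delta> g onorm in \<open>auto simp: has_vector_derivative_def\<close>)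
  moreover have "g \<delta> - g 0 =
      f (x + \<delta> *\<^sub>R b + \<delta> *\<^sub>R c) - f (x + \<delta> *\<^sub>R b) - f (x + \<delta> *\<^sub>R c) + f x - \<delta>\<^sup>2 *\<^sub>R L"
    by (simp add: g_def algebra_simps power2_eq_square)
  ultimately show ?thesis
    using \<delta> by (simp add: power2_eq_square ac_simps)
qed

lemma partial_deriv_commute:
  fixes f :: "'a::euclidean_space \<Rightarrow> complex"
  assumes diff: "\<And>y. f differentiable (at y)"
    and diff_b: "\<And>y. partial_deriv b f differentiable (at y)"
    and diff_c: "\<And>y. partial_deriv c f differentiable (at y)"
    and cont_cb: "isCont (partial_deriv c (partial_deriv b f)) x"
    and cont_bc: "isCont (partial_deriv b (partial_deriv c f)) x"
  shows "partial_deriv c (partial_deriv b f) x = partial_deriv b (partial_deriv c f) x"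
proof -
  let ?p = "partial_deriv c (partial_deriv b f)" and ?q = "partial_deriv b (partial_deriv c f)"
  have near: "\<exists>\<delta>0>0. \<forall>u w \<delta>. 0 \<le> u \<and> u \<le> \<delta> \<and> 0 \<le> w \<and> w \<le> \<delta> \<and> \<delta> \<le> \<delta>0 \<longrightarrow>
      norm (r (x + u *\<^sub>R d + w *\<^sub>R e) - r x) \<le> \<epsilon>"
    if r: "isCont r x" and \<epsilon>: "\<epsilon> > 0" for r :: "'a \<Rightarrow> complex" and d e \<epsilon>
  proof -
    obtain \<eta> where \<eta>: "\<eta> > 0" "\<And>y. dist y x < \<eta> \<Longrightarrow> dist (r y) (r x) < \<epsilon>"
      using r \<epsilon> unfolding continuous_at_eps_delta by (metis dist_commute dist_norm)
    define \<delta>0 where "\<delta>0 = \<eta> / (norm d + norm e + 1)"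
    have pos: "norm d + norm e + 1 > 0"
      by (smt (verit) norm_ge_zero)
    have \<delta>0: "\<delta>0 > 0" "\<delta>0 * (norm d + norm e + 1) = \<eta>"
      using \<eta> pos by (auto simp: \<delta>0_def field_simps)
    have "norm (r (x + u *\<^sub>R d + w *\<^sub>R e) - r x) \<le> \<epsilon>"
      if "0 \<le> u" "u \<le> \<delta>" "0 \<le> w" "w \<le> \<delta>" "\<delta> \<le> \<delta>0" for u w \<delta>
    proof -
      have "dist (x + u *\<^sub>R d + w *\<^sub>R e) x \<le> u * norm d + w * norm e"
        using norm_triangle_ineq[of "u *\<^sub>R d" "w *\<^sub>R e"] that by (simp add: dist_norm add.assoc)
      also have "\<dots> \<le> \<delta>0 * norm d + \<delta>0 * norm e"
        by (intro add_mono mult_right_mono) (use that in auto)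
      also have "\<dots> < \<eta>"
        using \<delta>0 by (simp add: algebra_simps)
      finally show ?thesis
        using \<eta>(2) by (simp add: dist_norm less_imp_le)
    qed
    with \<delta>0 show ?thesis
      by blast
  qed
  have "norm (?p x - ?q x) \<le> 2 * \<epsilon>" if \<epsilon>: "\<epsilon> > 0" for \<epsilon>
  proof -
    obtain \<delta>1 where \<delta>1: "\<delta>1 > 0" "\<And>u w \<delta>. \<lbrakk>0 \<le> u; u \<le> \<delta>; 0 \<le> w; w \<le> \<delta>; \<delta> \<le> \<delta>1\<rbrakk> \<Longrightarrow>
        norm (?p (x + u *\<^sub>R b + w *\<^sub>R c) - ?p x) \<le> \<epsilon>"
      using near[OF cont_cb \<epsilon>] by metis
    obtain \<delta>2 where \<delta>2: "\<delta>2 > 0" "\<And>u w \<delta>. \<lbrakk>0 \<le> u; u \<le> \<delta>; 0 \<le> w; w \<le> \<delta>; \<delta> \<le> \<delta>2\<rbrakk> \<Longrightarrow>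
        norm (?q (x + u *\<^sub>R c + w *\<^sub>R b) - ?q x) \<le> \<epsilon>"
      using near[OF cont_bc \<epsilon>] by metis
    define \<delta> where "\<delta> = min \<delta>1 \<delta>2"
    have \<delta>: "\<delta> > 0" "\<delta> \<le> \<delta>1" "\<delta> \<le> \<delta>2"
      using \<delta>1 \<delta>2 by (auto simp: \<delta>_def)
    define \<Delta> where "\<Delta> = f (x + \<delta> *\<^sub>R b + \<delta> *\<^sub>R c) - f (x + \<delta> *\<^sub>R b) - f (x + \<delta> *\<^sub>R c) + f x"
    have "norm (\<Delta> - \<delta>\<^sup>2 *\<^sub>R ?p x) \<le> \<delta>\<^sup>2 * \<epsilon>"
      unfolding \<Delta>_def
      by (rule mixed_difference_bound) (use \<delta> \<delta>1 diff diff_b in auto)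
    moreover have "norm (\<Delta> - \<delta>\<^sup>2 *\<^sub>R ?q x) \<le> \<delta>\<^sup>2 * \<epsilon>"
    proof -
      have "norm (f (x + \<delta> *\<^sub>R c + \<delta> *\<^sub>R b) - f (x + \<delta> *\<^sub>R c) - f (x + \<delta> *\<^sub>R b) + f x - \<delta>\<^sup>2 *\<^sub>R ?q x)
          \<le> \<delta>\<^sup>2 * \<epsilon>"
        by (rule mixed_difference_bound) (use \<delta> \<delta>2 diff diff_c in auto)
      then show ?thesis
        by (simp add: \<Delta>_def algebra_simps)
    qed
    ultimately have "norm ((\<Delta> - \<delta>\<^sup>2 *\<^sub>R ?q x) - (\<Delta> - \<delta>\<^sup>2 *\<^sub>R ?p x)) \<le> \<delta>\<^sup>2 * (2 * \<epsilon>)"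
      using norm_triangle_ineq4 by (smt (verit) distrib_left mult_2)
    moreover have "(\<Delta> - \<delta>\<^sup>2 *\<^sub>R ?q x) - (\<Delta> - \<delta>\<^sup>2 *\<^sub>R ?p x) = \<delta>\<^sup>2 *\<^sub>R (?p x - ?q x)"
      by (simp add: algebra_simps)
    ultimately show ?thesis
      using \<delta> by simp
  qed
  from this[of "norm (?p x - ?q x) / 4"] show ?thesis
    by (cases "?p x = ?q x") auto
qed

section \<open>Smooth functions and iterated partial derivatives\<close>

lemma smooth_differentiable: "smooth f \<Longrightarrow> f differentiable (at x)"
  unfolding smooth_def by (metis C_k.simps(2))

lemma smooth_isCont: "smooth f \<Longrightarrow> isCont f x"
  by (metis differentiable_imp_continuous_within smooth_differentiable)

lemma smooth_continuous_on: "smooth f \<Longrightarrow> continuous_on S f"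
  by (simp add: continuous_at_imp_continuous_on smooth_isCont)

lemma smooth_partial_deriv: "smooth f \<Longrightarrow> b \<in> Basis \<Longrightarrow> smooth (partial_deriv b f)"
  unfolding smooth_def by (metis C_k.simps(2))

lemma smooth_add_diff:
  assumes "smooth f" "smooth g"
  shows "smooth (\<lambda>x. f x + g x)" "smooth (\<lambda>x. f x - g x)"
proof -
  have "C_k k (\<lambda>x. f x + g x) \<and> C_k k (\<lambda>x. f x - g x)" for k
    using assms
  proof (induction k arbitrary: f g)
    case 0
    then show ?case
      by (simp add: continuous_on_add continuous_on_diff smooth_continuous_on)
  next
    case (Suc k)
    have "partial_deriv b (\<lambda>x. f x + g x) = (\<lambda>x. partial_deriv b f x + partial_deriv b g x)"
      "partial_deriv b (\<lambda>x. f x - g x) = (\<lambda>x. partial_deriv b f x - partial_deriv b g x)" for b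
      using Suc.prems
      by - (rule ext, simp add: partial_deriv_add partial_deriv_diff smooth_differentiable)+
    moreover have "C_k k (\<lambda>x. partial_deriv b f x + partial_deriv b g x) \<and>
        C_k k (\<lambda>x. partial_deriv b f x - partial_deriv b g x)" if "b \<in> Basis" for b
      using that by (intro Suc.IH smooth_partial_deriv Suc.prems)
    ultimately show ?case
      by (auto intro: differentiable_add differentiable_diff
          smooth_differentiable[OF Suc.prems(1)] smooth_differentiable[OF Suc.prems(2)])
  qed
  then show "smooth (\<lambda>x. f x + g x)" "smooth (\<lambda>x. f x - g x)"
    by (auto simp: smooth_def)
qed

lemma smooth_partial_deriv_commute:
  assumes "smooth f" "b \<in> Basis" "c \<in> Basis"
  shows "partial_deriv c (partial_deriv b f) = partial_deriv b (partial_deriv c f)"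
  by (rule ext, rule partial_deriv_commute)
    (use assms in \<open>auto intro!: smooth_differentiable smooth_isCont smooth_partial_deriv\<close>)

text \<open>
  The seminorms only know partial derivatives taken in the order of \<open>basis_list\<close>. Lists of
  directions, the last of which acts first, allow a single derivative to be taken before or after the
  others; \<open>derivs_cong_mset\<close> then restores the fixed order.
\<close>

definition derivs :: "'a::euclidean_space list \<Rightarrow> ('a \<Rightarrow> complex) \<Rightarrow> 'a \<Rightarrow> complex" where
  "derivs bs = foldr partial_deriv bs"

lemma derivs_simps [simp]:
  "derivs [] f = f"
  "derivs (b # bs) f = partial_deriv b (derivs bs f)"
  "derivs (bs @ cs) f = derivs bs (derivs cs f)"
  by (simp_all add: derivs_def)

lemma smooth_derivs: "smooth f \<Longrightarrow> set bs \<subseteq> Basis \<Longrightarrow> smooth (derivs bs f)"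
  by (induction bs) (auto simp: smooth_partial_deriv)

lemma derivs_add_diff:
  assumes "smooth f" "smooth g" "set bs \<subseteq> Basis"
  shows "derivs bs (\<lambda>x. f x + g x) = (\<lambda>x. derivs bs f x + derivs bs g x)"
    "derivs bs (\<lambda>x. f x - g x) = (\<lambda>x. derivs bs f x - derivs bs g x)"
  using assms(3)
  by (induction bs)
    (auto simp: partial_deriv_add partial_deriv_diff smooth_differentiable smooth_derivs assms(1,2))

lemma derivs_partial_deriv:
  assumes "smooth f" "b \<in> Basis" "set bs \<subseteq> Basis"
  shows "derivs bs (partial_deriv b f) = partial_deriv b (derivs bs f)"
  using assms(3)
proof (induction bs)
  case (Cons c bs)
  then show ?case
    using smooth_partial_deriv_commute[OF smooth_derivs[OF assms(1), of bs] assms(2), of c] by simp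
qed simp

lemma derivs_cong_mset:
  assumes "smooth f" "set bs \<subseteq> Basis" "mset bs = mset cs"
  shows "derivs bs f = derivs cs f"
  using assms(2,3)
proof (induction bs arbitrary: cs)
  case (Cons b bs)
  then have "b \<in> set cs"
    by (metis list.set_intros(1) mset_eq_setD)
  then obtain cs1 cs2 where cs: "cs = cs1 @ b # cs2"
    by (meson split_list)
  then have bs: "mset bs = mset (cs1 @ cs2)"
    using Cons.prems(2) by simp
  have sub: "set (cs1 @ cs2) \<subseteq> Basis"
    using Cons.prems(1) mset_eq_setD[OF bs] by auto
  have "derivs cs f = partial_deriv b (derivs cs1 (derivs cs2 f))"
    unfolding cs using Cons.prems(1) sub
    by (simp add: derivs_partial_deriv smooth_derivs assms(1))
  then show ?case
    using Cons.IH[OF _ bs] Cons.prems(1) by simp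
qed simp

definition index_list :: "('a::euclidean_space \<Rightarrow> nat) \<Rightarrow> 'a list" where
  "index_list \<alpha> = concat (map (\<lambda>b. replicate (\<alpha> b) b) basis_list)"

lemma multi_deriv_eq_derivs: "multi_deriv \<alpha> f = derivs (index_list \<alpha>) f"
proof -
  have rep: "derivs (replicate n b) g = (partial_deriv b ^^ n) g" for n and b :: 'a and g
    by (induction n) auto
  have "foldr (\<lambda>b. partial_deriv b ^^ \<alpha> b) bs f = derivs (concat (map (\<lambda>b. replicate (\<alpha> b) b) bs)) f" for bs
    by (induction bs) (auto simp: rep)
  then show ?thesis
    by (simp add: multi_deriv_def index_list_def)
qed

lemma set_index_list: "set (index_list \<alpha>) \<subseteq> Basis"
  by (auto simp: index_list_def basis_list)

lemma count_index_list: "count (mset (index_list \<alpha>)) b = (if b \<in> Basis then \<alpha> b else 0)"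
proof -
  have "count (mset (concat (map (\<lambda>b. replicate (\<alpha> b) b) bs))) b = (if b \<in> set bs then \<alpha> b else 0)"
    if "distinct bs" for bs
    using that by (induction bs) auto
  then show ?thesis
    by (simp add: index_list_def basis_list)
qed

text \<open>
  Every iterated partial derivative, in whatever order, is thus one of those that enter the Schwartz
  seminorms.
\<close>

lemma derivs_eq_multi_deriv:
  assumes "smooth f" "set bs \<subseteq> Basis"
  shows "derivs bs f = multi_deriv (count (mset bs)) f"
  unfolding multi_deriv_eq_derivs
proof (rule derivs_cong_mset[OF assms])
  show "mset bs = mset (index_list (count (mset bs)))"
  proof (rule multiset_eqI)
    fix b show "count (mset bs) b = count (mset (index_list (count (mset bs)))) b"
      using assms(2) unfolding count_index_list by (cases "b \<in> Basis") (auto simp: count_eq_zero_iff)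
  qed
qed

section \<open>Functionals bounded by Schwartz seminorms\<close>

lemma schwartz_smooth: "F \<in> schwartz_space \<Longrightarrow> smooth F"
  by (simp add: schwartz_space_def)

lemma schwartz_seminorm_upper:
  assumes "F \<in> schwartz_space"
  shows "\<bar>monomial \<alpha> x\<bar> * norm (multi_deriv \<beta> F x) \<le> schwartz_seminorm \<alpha> \<beta> F"
proof -
  have "bdd_above (range (\<lambda>x. norm (monomial \<alpha> x *\<^sub>R multi_deriv \<beta> F x)))"
    using assms by (auto simp: schwartz_space_def)
  from cSUP_upper[OF UNIV_I this, of x] show ?thesis
    by (simp add: schwartz_seminorm_def)
qed

lemma schwartz_seminorm_least:
  assumes "\<And>x. \<bar>monomial \<alpha> x\<bar> * norm (multi_deriv \<beta> F x) \<le> B"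
  shows "schwartz_seminorm \<alpha> \<beta> F \<le> B"
  unfolding schwartz_seminorm_def by (rule cSUP_least) (use assms in auto)

lemma schwartz_seminorm_nonneg: "F \<in> schwartz_space \<Longrightarrow> 0 \<le> schwartz_seminorm \<alpha> \<beta> F"
  using schwartz_seminorm_upper[of F \<alpha> undefined \<beta>]
  by (rule order_trans[rotated]) auto

lemma monomial_increment:
  assumes "b \<in> Basis"
  shows "monomial (\<alpha>(b := Suc (\<alpha> b))) x = (x \<bullet> b) * monomial \<alpha> x"
proof -
  have "(\<Prod>c\<in>Basis - {b}. (x \<bullet> c) ^ (\<alpha>(b := Suc (\<alpha> b))) c) = (\<Prod>c\<in>Basis - {b}. (x \<bullet> c) ^ \<alpha> c)"
    by (rule prod.cong) auto
  then show ?thesis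
    unfolding monomial_def prod.remove[OF finite_Basis assms] by simp
qed

lemma abs_monomial_le: "\<bar>monomial \<alpha> x\<bar> \<le> (1 + norm x) ^ (\<Sum>b\<in>Basis. \<alpha> b)"
proof -
  have "\<bar>monomial \<alpha> x\<bar> = (\<Prod>b\<in>Basis. \<bar>x \<bullet> b\<bar> ^ \<alpha> b)"
    by (simp add: monomial_def abs_prod power_abs)
  also have "\<dots> \<le> (\<Prod>b\<in>(Basis::'a set). (1 + norm x) ^ \<alpha> b)"
  proof (intro prod_mono conjI power_mono)
    fix b :: 'a assume "b \<in> Basis"
    from Basis_le_norm[OF this, of x] show "\<bar>x \<bullet> b\<bar> \<le> 1 + norm x"
      by simp
  qed auto
  finally show ?thesis
    by (simp add: power_sum)
qed

text \<open>
  This is the domination property that characterises the continuous seminorms among all seminorms on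
  the Schwartz space. It is formulated for arbitrary functionals and as an upper bound only, so that
  composite bounds can be assembled without checking subadditivity.
\<close>

definition controlled :: "(('a::euclidean_space \<Rightarrow> complex) \<Rightarrow> real) \<Rightarrow> bool" where
  "controlled q \<longleftrightarrow> (\<exists>C I. 0 \<le> C \<and> finite I \<and>
    (\<forall>F\<in>schwartz_space. q F \<le> C * (\<Sum>(\<alpha>, \<beta>)\<in>I. schwartz_seminorm \<alpha> \<beta> F)))"

lemma controlled_mono:
  assumes "controlled q" "\<And>F. F \<in> schwartz_space \<Longrightarrow> p F \<le> q F"
  shows "controlled p"
  using assms unfolding controlled_def by (meson order_trans)

lemma controlled_seminorm: "controlled (schwartz_seminorm \<alpha> \<beta>)"
  unfolding controlled_def by (rule exI[of _ 1], rule exI[of _ "{(\<alpha>, \<beta>)}"]) auto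

lemma controlled_add:
  assumes "controlled p" "controlled q"
  shows "controlled (\<lambda>F. p F + q F)"
proof -
  obtain C I where C: "0 \<le> C" "finite I"
      "\<And>F. F \<in> schwartz_space \<Longrightarrow> p F \<le> C * (\<Sum>(\<alpha>, \<beta>)\<in>I. schwartz_seminorm \<alpha> \<beta> F)"
    using assms(1) unfolding controlled_def by blast
  obtain D J where D: "0 \<le> D" "finite J"
      "\<And>F. F \<in> schwartz_space \<Longrightarrow> q F \<le> D * (\<Sum>(\<alpha>, \<beta>)\<in>J. schwartz_seminorm \<alpha> \<beta> F)"
    using assms(2) unfolding controlled_def by blast
  have "p F + q F \<le> (C + D) * (\<Sum>(\<alpha>, \<beta>)\<in>I \<union> J. schwartz_seminorm \<alpha> \<beta> F)"
    if F: "F \<in> schwartz_space" for F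
  proof -
    have "p F \<le> C * (\<Sum>(\<alpha>, \<beta>)\<in>I \<union> J. schwartz_seminorm \<alpha> \<beta> F)"
      by (rule order_trans[OF C(3)[OF F]], intro mult_left_mono sum_mono2)
        (use C D F in \<open>auto simp: schwartz_seminorm_nonneg\<close>)
    moreover have "q F \<le> D * (\<Sum>(\<alpha>, \<beta>)\<in>I \<union> J. schwartz_seminorm \<alpha> \<beta> F)"
      by (rule order_trans[OF D(3)[OF F]], intro mult_left_mono sum_mono2)
        (use C D F in \<open>auto simp: schwartz_seminorm_nonneg\<close>)
    ultimately show ?thesis
      by (simp add: distrib_right)
  qed
  then show ?thesis
    unfolding controlled_def using C D by (intro exI[of _ "C + D"] exI[of _ "I \<union> J"]) auto
qed

lemma controlled_zero: "controlled (\<lambda>_. 0)"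
  unfolding controlled_def by (rule exI[of _ 0], rule exI[of _ "{}"]) auto

lemma controlled_sum:
  assumes "\<And>i. i \<in> A \<Longrightarrow> controlled (q i)"
  shows "controlled (\<lambda>F. \<Sum>i\<in>A. q i F)"
  using assms
  by (induction A rule: infinite_finite_induct) (auto intro: controlled_add controlled_zero)

lemma controlled_scale:
  assumes "controlled q" "0 \<le> c"
  shows "controlled (\<lambda>F. c * q F)"
proof -
  obtain C I where C: "0 \<le> C" "finite I"
      "\<And>F. F \<in> schwartz_space \<Longrightarrow> q F \<le> C * (\<Sum>(\<alpha>, \<beta>)\<in>I. schwartz_seminorm \<alpha> \<beta> F)"
    using assms(1) unfolding controlled_def by blast
  have "c * q F \<le> c * C * (\<Sum>(\<alpha>, \<beta>)\<in>I. schwartz_seminorm \<alpha> \<beta> F)" if "F \<in> schwartz_space" for F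
    using mult_left_mono[OF C(3)[OF that] assms(2)] by (simp add: mult.assoc)
  then show ?thesis
    unfolding controlled_def using C(1,2) assms(2)
    by (intro exI[of _ "c * C"] exI[of _ I]) simp
qed

lemma controlled_compose:
  assumes q: "controlled q"
    and T: "\<And>F. F \<in> schwartz_space \<Longrightarrow> T F \<in> schwartz_space"
    and sem: "\<And>\<alpha> \<beta>. controlled (\<lambda>F. schwartz_seminorm \<alpha> \<beta> (T F))"
  shows "controlled (\<lambda>F. q (T F))"
proof -
  obtain C I where C: "0 \<le> C" "finite I"
      "\<And>F. F \<in> schwartz_space \<Longrightarrow> q F \<le> C * (\<Sum>(\<alpha>, \<beta>)\<in>I. schwartz_seminorm \<alpha> \<beta> F)"
    using q unfolding controlled_def by blast
  have "controlled (\<lambda>F. C * (\<Sum>(\<alpha>, \<beta>)\<in>I. schwartz_seminorm \<alpha> \<beta> (T F)))"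
    by (intro controlled_scale controlled_sum C) (auto simp: sem split: prod.split)
  then show ?thesis
    by (rule controlled_mono) (use C T in auto)
qed

text \<open>
  Polynomial weights in \<open>norm x\<close> are more convenient than monomials. Induction on \<open>k\<close>: one factor
  \<open>1 + norm x\<close> is at most \<open>1 + (\<Sum>b\<in>Basis. \<bar>x \<bullet> b\<bar>)\<close>, and \<open>\<bar>x \<bullet> b\<bar>\<close> raises the exponent
  of \<open>b\<close> in the monomial by one, which is why the induction runs over all \<open>\<alpha>\<close>.
\<close>

lemma controlled_weighted_deriv:
  assumes bs: "set bs \<subseteq> Basis"
  shows "\<exists>q. controlled q \<and> (\<forall>F\<in>schwartz_space. \<forall>x. (1 + norm x) ^ k * norm (derivs bs F x) \<le> q F)"
proof -
  have "\<exists>q. controlled q \<and> (\<forall>F\<in>schwartz_space. \<forall>x.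
      (1 + norm x) ^ k * (\<bar>monomial \<alpha> x\<bar> * norm (derivs bs F x)) \<le> q F)" for \<alpha>
  proof (induction k arbitrary: \<alpha>)
    case 0
    have "\<bar>monomial \<alpha> x\<bar> * norm (derivs bs F x) \<le> schwartz_seminorm \<alpha> (count (mset bs)) F"
      if "F \<in> schwartz_space" for F x
      using schwartz_seminorm_upper[OF that] derivs_eq_multi_deriv[OF schwartz_smooth[OF that] bs] by simp
    then show ?case
      using controlled_seminorm by (intro exI[of _ "schwartz_seminorm \<alpha> (count (mset bs))"]) auto
  next
    case (Suc k)
    obtain q where q: "\<And>\<alpha>. controlled (q \<alpha>)" "\<And>\<alpha> F x. F \<in> schwartz_space \<Longrightarrow>
        (1 + norm x) ^ k * (\<bar>monomial \<alpha> x\<bar> * norm (derivs bs F x)) \<le> q \<alpha> F"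
      using Suc by metis
    define q' where "q' F = q \<alpha> F + (\<Sum>b\<in>Basis. q (\<alpha>(b := Suc (\<alpha> b))) F)" for F
    have "controlled q'"
      unfolding q'_def by (intro controlled_add controlled_sum q)
    moreover have "(1 + norm x) ^ Suc k * (\<bar>monomial \<alpha> x\<bar> * norm (derivs bs F x)) \<le> q' F"
      if F: "F \<in> schwartz_space" for F x
    proof -
      let ?A = "(1 + norm x) ^ k * (\<bar>monomial \<alpha> x\<bar> * norm (derivs bs F x))"
      have "(1 + norm x) * ?A \<le> (1 + (\<Sum>b\<in>Basis. \<bar>x \<bullet> b\<bar>)) * ?A"
        by (intro mult_right_mono add_left_mono norm_le_l1) auto
      also have "\<dots> = ?A + (\<Sum>b\<in>Basis. \<bar>x \<bullet> b\<bar> * ?A)"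
        by (simp add: distrib_right sum_distrib_right)
      also have "(\<Sum>b\<in>Basis. \<bar>x \<bullet> b\<bar> * ?A) =
          (\<Sum>b\<in>Basis. (1 + norm x) ^ k * (\<bar>monomial (\<alpha>(b := Suc (\<alpha> b))) x\<bar> * norm (derivs bs F x)))"
        by (rule sum.cong) (auto simp: monomial_increment abs_mult simp del: fun_upd_apply)
      also have "?A + \<dots> \<le> q' F"
        unfolding q'_def by (intro add_mono sum_mono q F)
      finally show ?thesis
        by (simp add: mult.assoc)
    qed
    ultimately show ?case
      by blast
  qed
  from this[of "\<lambda>_. 0"] show ?thesis
    by (simp add: monomial_def)
qed

lemma schwartz_space_iff_weighted:
  "F \<in> schwartz_space \<longleftrightarrow> smooth F \<and>
    (\<forall>k bs. set bs \<subseteq> Basis \<longrightarrow> (\<exists>B. \<forall>x. (1 + norm x) ^ k * norm (derivs bs F x) \<le> B))"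
  (is "_ \<longleftrightarrow> _ \<and> ?R")
proof (intro iffI conjI)
  assume F: "F \<in> schwartz_space"
  then show "smooth F"
    by (rule schwartz_smooth)
  show ?R
    using controlled_weighted_deriv F by blast
next
  assume R: "smooth F \<and> ?R"
  have "bdd_above (range (\<lambda>x. norm (monomial \<alpha> x *\<^sub>R multi_deriv \<beta> F x)))" for \<alpha> \<beta>
  proof -
    obtain B where B: "\<And>x. (1 + norm x) ^ (\<Sum>b\<in>Basis. \<alpha> b) * norm (derivs (index_list \<beta>) F x) \<le> B"
      using R set_index_list by blast
    have "norm (monomial \<alpha> x *\<^sub>R multi_deriv \<beta> F x) \<le> B" for x
      using order_trans[OF mult_right_mono[OF abs_monomial_le norm_ge_zero] B]
      by (simp add: multi_deriv_eq_derivs)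
    then show ?thesis
      by (auto intro!: bdd_aboveI)
  qed
  with R show "F \<in> schwartz_space"
    by (simp add: schwartz_space_def)
qed

lemma schwartz_add_diff:
  assumes F: "F \<in> schwartz_space" and G: "G \<in> schwartz_space"
  shows "(\<lambda>x. F x + G x) \<in> schwartz_space" "(\<lambda>x. F x - G x) \<in> schwartz_space"
proof -
  note smooth = schwartz_smooth[OF F] schwartz_smooth[OF G]
  have "\<exists>B. \<forall>x. (1 + norm x) ^ k * norm (derivs bs F x + derivs bs G x) \<le> B \<and>
      (1 + norm x) ^ k * norm (derivs bs F x - derivs bs G x) \<le> B"
    if bs: "set bs \<subseteq> Basis" for k bs
  proof -
    obtain B C where B: "\<And>x. (1 + norm x) ^ k * norm (derivs bs F x) \<le> B"
      and C: "\<And>x. (1 + norm x) ^ k * norm (derivs bs G x) \<le> C"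
      using F G bs unfolding schwartz_space_iff_weighted by meson
    have "(1 + norm x) ^ k * norm z \<le> B + C"
      if "norm z \<le> norm (derivs bs F x) + norm (derivs bs G x)" for x z
      using mult_left_mono[OF that, of "(1 + norm x) ^ k"] B[of x] C[of x]
      by (simp add: distrib_left)
    then show ?thesis
      using norm_triangle_ineq norm_triangle_ineq4 by blast
  qed
  then show "(\<lambda>x. F x + G x) \<in> schwartz_space" "(\<lambda>x. F x - G x) \<in> schwartz_space"
    unfolding schwartz_space_iff_weighted
    by (auto simp: smooth_add_diff smooth derivs_add_diff) meson+
qed

lemma schwartz_seminorm_triangle:
  assumes F: "F \<in> schwartz_space" and G: "G \<in> schwartz_space"
  shows "schwartz_seminorm \<alpha> \<beta> (\<lambda>x. F x + G x) \<le> schwartz_seminorm \<alpha> \<beta> F + schwartz_seminorm \<alpha> \<beta> G"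
proof (rule schwartz_seminorm_least)
  fix x
  have "multi_deriv \<beta> (\<lambda>x. F x + G x) x = multi_deriv \<beta> F x + multi_deriv \<beta> G x"
    by (simp add: multi_deriv_eq_derivs derivs_add_diff schwartz_smooth F G set_index_list)
  then have "\<bar>monomial \<alpha> x\<bar> * norm (multi_deriv \<beta> (\<lambda>x. F x + G x) x)
      \<le> \<bar>monomial \<alpha> x\<bar> * (norm (multi_deriv \<beta> F x) + norm (multi_deriv \<beta> G x))"
    by (simp add: mult_left_mono norm_triangle_ineq)
  also have "\<dots> \<le> schwartz_seminorm \<alpha> \<beta> F + schwartz_seminorm \<alpha> \<beta> G"
    unfolding distrib_left by (intro add_mono schwartz_seminorm_upper F G)
  finally show "\<bar>monomial \<alpha> x\<bar> * norm (multi_deriv \<beta> (\<lambda>x. F x + G x) x)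
      \<le> schwartz_seminorm \<alpha> \<beta> F + schwartz_seminorm \<alpha> \<beta> G" .
qed

lemma schwartz_partial_deriv:
  assumes F: "F \<in> schwartz_space" and b: "b \<in> Basis"
  shows "partial_deriv b F \<in> schwartz_space"
proof -
  have "\<exists>B. \<forall>x. (1 + norm x) ^ k * norm (derivs bs (partial_deriv b F) x) \<le> B"
    if "set bs \<subseteq> Basis" for k bs
  proof -
    have "set (bs @ [b]) \<subseteq> Basis"
      using that b by simp
    then have "\<exists>B. \<forall>x. (1 + norm x) ^ k * norm (derivs (bs @ [b]) F x) \<le> B"
      using F unfolding schwartz_space_iff_weighted by blast
    then show ?thesis
      by simp
  qed
  then show ?thesis
    unfolding schwartz_space_iff_weighted using F b by (simp add: schwartz_smooth smooth_partial_deriv)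
qed

lemma controlled_seminorm_partial_deriv:
  assumes b: "b \<in> Basis"
  shows "controlled (\<lambda>F. schwartz_seminorm \<alpha> \<beta> (partial_deriv b F))"
proof (rule controlled_mono[OF controlled_seminorm])
  fix F :: "'a \<Rightarrow> complex" assume F: "F \<in> schwartz_space"
  have "set (index_list \<beta> @ [b]) \<subseteq> Basis"
    using b set_index_list by auto
  from derivs_eq_multi_deriv[OF schwartz_smooth[OF F] this]
  show "schwartz_seminorm \<alpha> \<beta> (partial_deriv b F)
      \<le> schwartz_seminorm \<alpha> (count (mset (index_list \<beta> @ [b]))) F"
    by (simp add: schwartz_seminorm_def multi_deriv_eq_derivs[of \<beta>])
qed

lemma controlled_partial_deriv:
  assumes "controlled q" "b \<in> Basis"
  shows "controlled (\<lambda>F. q (partial_deriv b F))"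
  using controlled_compose[OF assms(1)] schwartz_partial_deriv[OF _ assms(2)]
    controlled_seminorm_partial_deriv[OF assms(2)] by blast

text \<open>
  The usual criterion for linear maps between locally convex spaces: pulling back each seminorm of
  the target gives a functional dominated by finitely many seminorms of the source. Linearity enters
  as the compatibility with differences, which turns \<open>T F - T G\<close> into \<open>T (F - G)\<close> and thus
  transports the estimate from \<open>0\<close> to an arbitrary base point \<open>G\<close>.
\<close>

lemma continuous_map_schwartz:
  assumes V: "V \<subseteq> schwartz_space"
    and V_diff: "\<And>F G. \<lbrakk>F \<in> V; G \<in> V\<rbrakk> \<Longrightarrow> (\<lambda>x. F x - G x) \<in> V"
    and T: "\<And>F. F \<in> V \<Longrightarrow> T F \<in> schwartz_space"
    and T_diff: "\<And>F G. \<lbrakk>F \<in> V; G \<in> V\<rbrakk> \<Longrightarrow> T (\<lambda>x. F x - G x) = (\<lambda>x. T F x - T G x)"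
    and bound: "\<And>\<alpha> \<beta>. \<exists>q. controlled q \<and> (\<forall>F\<in>V. schwartz_seminorm \<alpha> \<beta> (T F) \<le> q F)"
  shows "continuous_map (subtopology schwartz_topology V) schwartz_topology T"
proof -
  let ?X = "subtopology schwartz_topology V"
  have top: "topspace ?X = V"
    using V by (auto simp: topspace_schwartz_topology)
  have nbhd: "openin ?X (T -` {f \<in> schwartz_space. schwartz_seminorm \<alpha> \<beta> (\<lambda>x. f x - g x) < \<epsilon>} \<inter> V)"
    (is "openin ?X ?U") if g: "g \<in> schwartz_space" for \<alpha> \<beta> g \<epsilon>
  proof (subst openin_subopen, intro ballI)
    fix G assume "G \<in> ?U"
    then have G: "G \<in> V" and less: "schwartz_seminorm \<alpha> \<beta> (\<lambda>x. T G x - g x) < \<epsilon>"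
      by auto
    obtain C I where C: "0 \<le> C" "finite I" "\<And>F. F \<in> V \<Longrightarrow>
        schwartz_seminorm \<alpha> \<beta> (T F) \<le> C * (\<Sum>(\<alpha>, \<beta>)\<in>I. schwartz_seminorm \<alpha> \<beta> F)"
      using bound[of \<alpha> \<beta>] V unfolding controlled_def by (meson order_trans subsetD)
    \<comment> \<open>The slack \<open>r\<close> is distributed over the \<open>card I\<close> seminorms; adding \<open>1\<close> to the denominator
      covers the cases \<open>C = 0\<close> and \<open>I = {}\<close>.\<close>
    define r where "r = \<epsilon> - schwartz_seminorm \<alpha> \<beta> (\<lambda>x. T G x - g x)"
    define \<delta> where "\<delta> = r / (C * card I + 1)"
    have pos: "C * card I + 1 > 0"
      using C by (simp add: add_nonneg_pos)
    then have "(C * card I + 1) * \<delta> = r"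
      by (simp add: \<delta>_def)
    then have \<delta>_sum: "C * card I * \<delta> + \<delta> = r"
      by (simp add: distrib_right)
    have \<delta>: "\<delta> > 0"
      using less pos by (simp add: \<delta>_def r_def)
    define W where "W = (\<lambda>(\<alpha>, \<beta>). {F \<in> schwartz_space. schwartz_seminorm \<alpha> \<beta> (\<lambda>x. F x - G x) < \<delta>})"
    have "openin schwartz_topology (W i)" for i
    proof (cases i)
      case (Pair \<alpha> \<beta>)
      then show ?thesis
        unfolding schwartz_topology_def W_def
        by (auto intro!: topology_generated_by_Basis) (use G V \<delta> in blast)
    qed
    then have "openin schwartz_topology ((\<Inter>i\<in>I. W i) \<inter> topspace schwartz_topology)"
      using C(2) by (intro openin_INT) auto
    then have "openin ?X ((\<Inter>i\<in>I. W i) \<inter> topspace schwartz_topology \<inter> V)"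
      by (rule openin_subtopology_Int)
    moreover have "G \<in> (\<Inter>i\<in>I. W i) \<inter> topspace schwartz_topology \<inter> V"
    proof -
      have "smooth G"
        by (rule schwartz_smooth[OF subsetD[OF V G]])
      then have "multi_deriv \<beta> (\<lambda>x. G x - G x) = (\<lambda>_. 0)" for \<beta>
        using derivs_add_diff(2)[of G G, OF _ _ set_index_list]
        by (simp add: multi_deriv_eq_derivs)
      then have "schwartz_seminorm \<alpha> \<beta> (\<lambda>x. G x - G x) \<le> 0" for \<alpha> \<beta>
        by (intro schwartz_seminorm_least) simp
      then show ?thesis
        using G V le_less_trans[OF _ \<delta>]
        by (auto simp: W_def topspace_schwartz_topology simp del: diff_self)
    qed
    moreover have "(\<Inter>i\<in>I. W i) \<inter> topspace schwartz_topology \<inter> V \<subseteq> ?U"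
    proof
      fix F assume F: "F \<in> (\<Inter>i\<in>I. W i) \<inter> topspace schwartz_topology \<inter> V"
      then have FV: "F \<in> V"
        by blast
      have "schwartz_seminorm \<alpha> \<beta> (\<lambda>x. T F x - T G x) \<le>
          C * (\<Sum>(\<alpha>, \<beta>)\<in>I. schwartz_seminorm \<alpha> \<beta> (\<lambda>x. F x - G x))"
        using C(3)[OF V_diff[OF FV G]] by (simp add: T_diff FV G)
      also have "\<dots> \<le> C * (\<Sum>i\<in>I. \<delta>)"
        by (intro mult_left_mono sum_mono C(1)) (use F in \<open>force simp: W_def split: prod.splits\<close>)
      also have "\<dots> < r"
          using \<delta> \<delta>_sum by (simp add: mult.assoc)
      finally have less_r: "schwartz_seminorm \<alpha> \<beta> (\<lambda>x. T F x - T G x) < r" .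
      have "schwartz_seminorm \<alpha> \<beta> (\<lambda>x. (T F x - T G x) + (T G x - g x))
          \<le> schwartz_seminorm \<alpha> \<beta> (\<lambda>x. T F x - T G x) + schwartz_seminorm \<alpha> \<beta> (\<lambda>x. T G x - g x)"
        by (intro schwartz_seminorm_triangle schwartz_add_diff T FV G g)
      with less_r show "F \<in> ?U"
        using T[OF FV] FV by (simp add: r_def)
    qed
    ultimately show "\<exists>W. openin ?X W \<and> G \<in> W \<and> W \<subseteq> ?U"
      by blast
  qed
  have "T ` V \<subseteq> topspace schwartz_topology"
    using T by (auto simp: topspace_schwartz_topology)
  then show ?thesis
    unfolding schwartz_topology_def[where 'a = 'b] continuous_on_generated_topo_iff top
      topology_generated_by_topspace
    using nbhd by blast
qed

section \<open>Functions that are flat on the diagonal\<close>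

text \<open>
  Derivatives along arbitrary lists of directions are required to vanish, so that the class is closed
  under single partial derivatives: the additional direction is appended to the list. The Taylor
  argument at the diagonal and the iterated differentiation of the integral depend on this closure.
\<close>

definition flat_schwartz :: "('a::euclidean_space \<times> 'a \<Rightarrow> complex) set" where
  "flat_schwartz = {F \<in> schwartz_space. \<forall>bs z. set bs \<subseteq> Basis \<longrightarrow> derivs bs F (z, z) = 0}"

lemma flat_schwartzD:
  assumes "F \<in> flat_schwartz"
  shows "F \<in> schwartz_space" "smooth F" "F (z, z) = 0" "set bs \<subseteq> Basis \<Longrightarrow> derivs bs F (z, z) = 0"
proof -
  have *: "\<forall>bs z. set bs \<subseteq> Basis \<longrightarrow> derivs bs F (z, z) = 0"
    using assms by (simp add: flat_schwartz_def)
  from *[rule_format, of "[]" z] show "F (z, z) = 0"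
    by simp
  from * show "set bs \<subseteq> Basis \<Longrightarrow> derivs bs F (z, z) = 0"
    by simp
qed (use assms in \<open>auto simp: flat_schwartz_def schwartz_smooth\<close>)

lemma flat_schwartz_partial_deriv:
  assumes "F \<in> flat_schwartz" "e \<in> Basis"
  shows "partial_deriv e F \<in> flat_schwartz"
proof -
  have "derivs bs (partial_deriv e F) (z, z) = 0" if "set bs \<subseteq> Basis" for bs z
    using flat_schwartzD(4)[OF assms(1), of "bs @ [e]" z] that assms(2) by simp
  then show ?thesis
    using assms schwartz_partial_deriv flat_schwartzD(1) by (auto simp: flat_schwartz_def)
qed

lemma flat_schwartz_add_diff:
  assumes "F \<in> flat_schwartz" "G \<in> flat_schwartz"
  shows "(\<lambda>z. F z + G z) \<in> flat_schwartz" "(\<lambda>z. F z - G z) \<in> flat_schwartz"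
  using assms
  by (auto simp: flat_schwartz_def schwartz_add_diff derivs_add_diff schwartz_smooth)

text \<open>
  Taylor's theorem at the diagonal, in the direction \<open>(0, h)\<close>. By the mean value inequality,
  \<open>F (x, x + h)\<close> is at most \<open>norm h\<close> times the derivatives of \<open>F\<close> in the second variable on the
  segment from \<open>(x, x)\<close> to \<open>(x, x + h)\<close>; these derivatives are again flat on the diagonal, so each
  further application gains another factor \<open>norm h\<close>. The weight depends on \<open>x\<close> only and is
  constant on the segment.
\<close>

lemma controlled_vanishing_at_diagonal:
  fixes k N :: nat
  shows "\<exists>q :: ('a::euclidean_space \<times> 'a \<Rightarrow> complex) \<Rightarrow> real. controlled q \<and>
    (\<forall>F\<in>flat_schwartz. 0 \<le> q F \<and> (\<forall>x h. (1 + norm x) ^ k * norm (F (x, x + h)) \<le> norm h ^ N * q F))"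
proof (induction N)
  case 0
  obtain q :: "('a \<times> 'a \<Rightarrow> complex) \<Rightarrow> real" where q: "controlled q"
      "\<And>F z. F \<in> schwartz_space \<Longrightarrow> (1 + norm z) ^ k * norm (F z) \<le> q F"
    using controlled_weighted_deriv[of "[]" k] by auto
  have "(1 + norm x) ^ k * norm (F (x, x + h)) \<le> q F" if "F \<in> flat_schwartz" for F x h
  proof -
    have "(1 + norm x) ^ k * norm (F (x, x + h)) \<le> (1 + norm (x, x + h)) ^ k * norm (F (x, x + h))"
      by (intro mult_right_mono power_mono add_left_mono) (auto simp: norm_Pair)
    also have "\<dots> \<le> q F"
      by (rule q flat_schwartzD that)+
    finally show ?thesis .
  qed
  moreover have "0 \<le> q F" if "F \<in> flat_schwartz" for F
    using calculation[OF that, of 0 0] flat_schwartzD(3)[OF that, of 0] by simp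
  ultimately show ?case
    using q(1) by auto
next
  case (Suc N)
  then obtain q :: "('a \<times> 'a \<Rightarrow> complex) \<Rightarrow> real"
    where q: "controlled q" "\<And>F. F \<in> flat_schwartz \<Longrightarrow> 0 \<le> q F"
      "\<And>F x h. F \<in> flat_schwartz \<Longrightarrow> (1 + norm x) ^ k * norm (F (x, x + h)) \<le> norm h ^ N * q F"
    by blast
  define q' where "q' F = (\<Sum>b\<in>Basis. q (partial_deriv (0, b) F))" for F :: "'a \<times> 'a \<Rightarrow> complex"
  have basis: "(0, b) \<in> Basis" if "b \<in> Basis" for b :: 'a
    using that by (simp add: Basis_prod_def)
  have "controlled q'"
    unfolding q'_def by (intro controlled_sum controlled_partial_deriv q basis)
  moreover have "0 \<le> q' F" if "F \<in> flat_schwartz" for F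
    unfolding q'_def by (intro sum_nonneg q flat_schwartz_partial_deriv that basis)
  moreover have "(1 + norm x) ^ k * norm (F (x, x + h)) \<le> norm h ^ Suc N * q' F"
    if F: "F \<in> flat_schwartz" for F x h
  proof -
    let ?w = "(1 + norm x) ^ k" and ?f = "\<lambda>y. F (x, y)"
    have w: "?w > 0"
      by (intro zero_less_power) (auto intro: add_pos_nonneg)
    have partial: "partial_deriv b ?f y = partial_deriv (0, b) F (x, y)" for b y
      by (simp add: partial_deriv_def)
    have "norm (?f (x + h) - ?f x) \<le> norm h * (\<Sum>b\<in>Basis. norm h ^ N * q (partial_deriv (0, b) F) / ?w)"
    proof (rule mean_value_partials)
      show "?f differentiable (at y)" for y
      proof (rule differentiable_compose[where f = F])
        show "F differentiable (at (x, y))"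
          by (intro smooth_differentiable flat_schwartzD[OF F])
        show "Pair x differentiable (at y)"
          by (rule differentiableI[OF has_derivative_Pair[OF has_derivative_const has_derivative_ident]])
      qed
      fix t :: real and b :: 'a assume t: "0 \<le> t" "t \<le> 1" and b: "b \<in> Basis"
      note flat = flat_schwartz_partial_deriv[OF F basis[OF b]]
      have "norm (partial_deriv b ?f (x + t *\<^sub>R h)) * ?w \<le> norm (t *\<^sub>R h) ^ N * q (partial_deriv (0, b) F)"
        unfolding partial using q(3)[OF flat, of x "t *\<^sub>R h"] by (simp add: mult.commute)
      also have "\<dots> \<le> norm h ^ N * q (partial_deriv (0, b) F)"
        by (intro mult_right_mono power_mono q flat) (use t in \<open>auto simp: mult_left_le_one_le\<close>)
      finally show "norm (partial_deriv b ?f (x + t *\<^sub>R h)) \<le> norm h ^ N * q (partial_deriv (0, b) F) / ?w"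
        using w by (simp add: pos_le_divide_eq)
    qed
    also have "\<dots> = norm h ^ Suc N * q' F / ?w"
      by (simp add: q'_def sum_distrib_left sum_divide_distrib mult.assoc)
    finally show ?thesis
      using w flat_schwartzD(3)[OF F, of x] by (simp add: pos_le_divide_eq mult.commute)
  qed
  ultimately show ?case
    by blast
qed

text \<open>
  On \<open>z = (x, x + h)\<close> both \<open>norm x\<close> and \<open>norm h / 2\<close> are at most \<open>norm z\<close>, so Schwartz decay in
  \<open>z\<close> gives decay in \<open>x\<close> and in \<open>h\<close>.
\<close>

lemma controlled_decay_off_diagonal:
  fixes k M :: nat
  shows "\<exists>q :: ('a::euclidean_space \<times> 'a \<Rightarrow> complex) \<Rightarrow> real. controlled q \<and>
    (\<forall>F\<in>schwartz_space. \<forall>x h. (1 + norm x) ^ k * ((1 + norm h) ^ M * norm (F (x, x + h))) \<le> q F)"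
proof -
  obtain q :: "('a \<times> 'a \<Rightarrow> complex) \<Rightarrow> real" where q: "controlled q"
      "\<And>F z. F \<in> schwartz_space \<Longrightarrow> (1 + norm z) ^ (k + M) * norm (F z) \<le> q F"
    using controlled_weighted_deriv[of "[]" "k + M"] by auto
  have "(1 + norm x) ^ k * ((1 + norm h) ^ M * norm (F (x, x + h))) \<le> 2 ^ M * q F"
    if F: "F \<in> schwartz_space" for F x h
  proof -
    let ?z = "(x, x + h)"
    have x: "norm x \<le> norm ?z"
      by (simp add: norm_Pair)
    moreover have "norm (x + h) \<le> norm ?z"
      by (simp add: norm_Pair)
    ultimately have h: "1 + norm h \<le> 2 * (1 + norm ?z)"
      using norm_triangle_ineq4[of "x + h" x] by simp
    have "(1 + norm x) ^ k * (1 + norm h) ^ M \<le> (1 + norm ?z) ^ k * (2 * (1 + norm ?z)) ^ M"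
      by (intro mult_mono power_mono) (use x h in auto)
    also have "\<dots> = 2 ^ M * (1 + norm ?z) ^ (k + M)"
      unfolding power_mult_distrib power_add by (simp only: ac_simps)
    finally have "(1 + norm x) ^ k * (1 + norm h) ^ M * norm (F ?z)
        \<le> 2 ^ M * (1 + norm ?z) ^ (k + M) * norm (F ?z)"
      by (rule mult_right_mono) simp
    also have "\<dots> \<le> 2 ^ M * q F"
      using q(2)[OF F, of ?z] by (simp add: mult.assoc)
    finally show ?thesis
      by (simp add: mult.assoc)
  qed
  then show ?thesis
    using controlled_scale[OF q(1), of "2 ^ M"] by (intro exI[of _ "\<lambda>F. 2 ^ M * q F"]) auto
qed

text \<open>
  The kernel may be arbitrarily singular at \<open>h = 0\<close> or grow arbitrarily fast at infinity: the
  former is compensated by the vanishing of \<open>F\<close> on the diagonal, the latter by its decay. The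
  majorant does not depend on \<open>x\<close>, and its exponent makes it integrable.
\<close>

lemma controlled_kernel_bound:
  fixes a :: real and k :: nat
  shows "\<exists>q :: ('a::euclidean_space \<times> 'a \<Rightarrow> complex) \<Rightarrow> real. controlled q \<and>
    (\<forall>F\<in>flat_schwartz. 0 \<le> q F \<and> (\<forall>x h.
      (1 + norm x) ^ k * (norm (F (x, x + h)) * norm h powr a) \<le> q F * (1 / (1 + norm h) ^ (DIM('a) + 2))))"
proof -
  let ?d = "DIM('a) + 2"
  \<comment> \<open>One integer exponent serves both regions: for \<open>norm h \<le> 1\<close> a factor \<open>norm h ^ m\<close> absorbs
    the singularity of \<open>norm h powr a\<close>, and for \<open>norm h > 1\<close> its growth is at most that of
    \<open>(1 + norm h) ^ m\<close>.\<close>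
  obtain m :: nat where m: "\<bar>a\<bar> \<le> real m"
    using real_arch_simple by blast
  obtain q1 :: "('a \<times> 'a \<Rightarrow> complex) \<Rightarrow> real" where q1: "controlled q1"
    "\<And>F. F \<in> flat_schwartz \<Longrightarrow> 0 \<le> q1 F"
    "\<And>F x h. F \<in> flat_schwartz \<Longrightarrow> (1 + norm x) ^ k * norm (F (x, x + h)) \<le> norm h ^ m * q1 F"
    using controlled_vanishing_at_diagonal[of k m] by blast
  obtain q2 :: "('a \<times> 'a \<Rightarrow> complex) \<Rightarrow> real" where q2: "controlled q2"
    "\<And>F x h. F \<in> schwartz_space \<Longrightarrow>
      (1 + norm x) ^ k * ((1 + norm h) ^ (m + ?d) * norm (F (x, x + h))) \<le> q2 F"
    using controlled_decay_off_diagonal[of k "m + ?d"] by blast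
  define q where "q F = 2 ^ ?d * q1 F + q2 F" for F :: "'a \<times> 'a \<Rightarrow> complex"
  have "controlled q"
    unfolding q_def by (intro controlled_add controlled_scale q1 q2) auto
  moreover have nonneg: "0 \<le> q2 F" "0 \<le> q F" if F: "F \<in> flat_schwartz" for F
    using q2(2)[OF flat_schwartzD(1)[OF F], of 0 0] q1(2)[OF F] flat_schwartzD(3)[OF F, of 0]
    by (auto simp: q_def)
  moreover have "(1 + norm x) ^ k * (norm (F (x, x + h)) * norm h powr a) \<le> q F * (1 / (1 + norm h) ^ ?d)"
    if F: "F \<in> flat_schwartz" for F x h
  proof -
    let ?A = "(1 + norm x) ^ k * norm (F (x, x + h))"
    have pos: "1 + norm h > 0"
      by (simp add: add_pos_nonneg)
    have "?A * norm h powr a * (1 + norm h) ^ ?d \<le> q F"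
    proof (cases "norm h \<le> 1")
      case True
      have "?A * norm h powr a \<le> norm h ^ m * q1 F * norm h powr a"
        by (intro mult_right_mono q1 F) auto
      also have "\<dots> = q1 F * (norm h ^ m * norm h powr a)"
        by simp
      also have "\<dots> \<le> q1 F * 1"
      proof (intro mult_left_mono q1 F)
        show "norm h ^ m * norm h powr a \<le> 1"
        proof (cases "h = 0")
          case False
          then have "norm h ^ m * norm h powr a = norm h powr (real m + a)"
            by (simp add: powr_add powr_realpow)
          also have "\<dots> \<le> 1"
            using True m by (intro powr_le1) auto
          finally show ?thesis .
        qed simp
      qed
      finally have "?A * norm h powr a * (1 + norm h) ^ ?d \<le> q1 F * 2 ^ ?d"
        by (intro mult_mono power_mono) (use True q1(2)[OF F] in auto)
      then show ?thesis
        using nonneg[OF F] by (simp add: q_def mult.commute)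
    next
      case False
      have "norm h powr a \<le> norm h powr (real m)"
        using False m by (intro powr_mono) auto
      also have "\<dots> = norm h ^ m"
        using False by (intro powr_realpow) auto
      also have "\<dots> \<le> (1 + norm h) ^ m"
        by (intro power_mono) auto
      finally have "?A * norm h powr a * (1 + norm h) ^ ?d \<le> ?A * (1 + norm h) ^ m * (1 + norm h) ^ ?d"
        by (intro mult_right_mono mult_left_mono) auto
      also have "\<dots> = (1 + norm x) ^ k * ((1 + norm h) ^ (m + ?d) * norm (F (x, x + h)))"
        unfolding power_add by simp
      also have "\<dots> \<le> q2 F"
        by (rule q2(2)[OF flat_schwartzD(1)[OF F]])
      finally show ?thesis
        using mult_nonneg_nonneg[OF zero_le_power[of 2 ?d] q1(2)[OF F]] unfolding q_def by linarith
    qed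
    then show ?thesis
      using pos by (simp add: pos_le_divide_eq mult.assoc)
  qed
  ultimately show ?thesis
    by blast
qed

section \<open>Singular integrals across the diagonal\<close>

text \<open>
  The function is dominated by a sum over \<open>k\<close> of constants \<open>(1 + k) ^ -(n + 2)\<close> on balls of radius
  \<open>1 + k\<close>, where \<open>n\<close> is the dimension. The volume of such a ball is proportional to
  \<open>(1 + k) ^ n\<close>, which leaves the convergent series of inverse squares.
\<close>

lemma integrable_inverse_power_norm:
  "integrable lborel (\<lambda>h::'a::euclidean_space. 1 / (1 + norm h) ^ (DIM('a) + 2))"
proof (rule integrableI_bounded)
  let ?n = "DIM('a)"
  let ?V = "unit_ball_vol (real ?n)"
  let ?c = "\<lambda>k::nat. 1 / (1 + real k) ^ (?n + 2)"
  define g where "g k h = ennreal (?c k) * indicator (cball 0 (1 + real k)) h" for k and h :: 'a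
  show "(\<lambda>h::'a. 1 / (1 + norm h) ^ (?n + 2)) \<in> borel_measurable lborel"
    by measurable
  have pointwise: "ennreal (norm (1 / (1 + norm h) ^ (?n + 2))) \<le> (\<Sum>k. g k h)" for h :: 'a
  proof -
    define k where "k = nat \<lfloor>norm h\<rfloor>"
    have k: "real k \<le> norm h" "norm h \<le> 1 + real k"
      unfolding k_def by (simp_all add: of_nat_floor) linarith
    have "1 / (1 + norm h) ^ (?n + 2) \<le> ?c k"
      by (intro divide_left_mono power_mono mult_pos_pos zero_less_power) (use k in \<open>auto intro: add_pos_nonneg\<close>)
    then have "ennreal (norm (1 / (1 + norm h) ^ (?n + 2))) \<le> g k h"
      using k by (simp add: g_def ennreal_leI)
    also have "\<dots> \<le> (\<Sum>k. g k h)"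
      using sum_le_suminf[of "\<lambda>k. g k h" "{k}"] by simp
    finally show ?thesis .
  qed
  have layer: "(\<integral>\<^sup>+h. g k h \<partial>lborel) = ennreal (?V * (1 / real (Suc k) ^ 2))" for k
  proof -
    have "(\<integral>\<^sup>+h. g k h \<partial>lborel) = ennreal (?c k) * ennreal (?V * (1 + real k) ^ ?n)"
      unfolding g_def
      by (subst nn_integral_cmult_indicator) (simp_all add: emeasure_cball)
    also have "\<dots> = ennreal (?c k * (?V * (1 + real k) ^ ?n))"
      by (rule ennreal_mult[symmetric]) auto
    also have "?c k * (?V * (1 + real k) ^ ?n) = ?V * (1 / real (Suc k) ^ 2)"
    proof -
      have "1 / r ^ (?n + 2) * (?V * r ^ ?n) = ?V * (1 / r ^ 2)" if "r > 0" for r :: real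
        using that by (simp add: power_add power2_eq_square)
      from this[of "1 + real k"] show ?thesis
        by simp
    qed
    finally show ?thesis .
  qed
  have "summable (\<lambda>k. 1 / real (Suc k) ^ 2)"
    using inverse_power_summable[of 2, where 'a = real] summable_Suc_iff[of "\<lambda>k. inverse (real k ^ 2)"]
    by (simp add: inverse_eq_divide)
  from summable_mult[OF this, of ?V]
  have sum: "(\<Sum>k. ennreal (?V * (1 / real (Suc k) ^ 2))) < \<infinity>"
    by (subst suminf_ennreal2) simp_all
  have "(\<integral>\<^sup>+h. ennreal (norm (1 / (1 + norm (h::'a)) ^ (?n + 2))) \<partial>lborel) \<le> (\<integral>\<^sup>+h. (\<Sum>k. g k h) \<partial>lborel)"
    by (intro nn_integral_mono pointwise)
  also have "\<dots> = (\<Sum>k. \<integral>\<^sup>+h. g k h \<partial>lborel)"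
  proof (rule nn_integral_suminf)
    have [measurable]: "cball (0::'a) r \<in> sets borel" for r
      by simp
    show "g k \<in> borel_measurable lborel" for k
      unfolding g_def by measurable
  qed
  also have "\<dots> < \<infinity>"
    unfolding layer by (rule sum)
  finally show "(\<integral>\<^sup>+h. ennreal (norm (1 / (1 + norm (h::'a)) ^ (?n + 2))) \<partial>lborel) < \<infinity>" .
qed

text \<open>
  This is half the divergence in the variable \<open>h = y - x\<close>, with \<open>a = -(s + n)\<close>. In this form the
  singularity does not move with \<open>x\<close>, so that \<open>x\<close>-derivatives fall on \<open>F\<close> alone.
\<close>

definition diag_integral :: "real \<Rightarrow> ('a::euclidean_space \<times> 'a \<Rightarrow> complex) \<Rightarrow> 'a \<Rightarrow> complex" where
  "diag_integral a F x = (LINT h|lborel. (norm h powr a) *\<^sub>R F (x, x + h))"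

lemma measurable_diag_integrand:
  fixes F :: "'a::euclidean_space \<times> 'a \<Rightarrow> complex"
  assumes "smooth F"
  shows "(\<lambda>h. (norm h powr a) *\<^sub>R F (x, x + h)) \<in> borel_measurable lborel"
proof -
  have "continuous_on UNIV (\<lambda>h. F (x, x + h))"
    by (rule continuous_on_compose2[OF smooth_continuous_on[OF assms, of UNIV]])
      (auto intro!: continuous_intros)
  then have [measurable]: "(\<lambda>h. F (x, x + h)) \<in> borel_measurable borel"
    by (rule borel_measurable_continuous_onI)
  show ?thesis
    by measurable
qed

lemma integrable_diag_integrand:
  fixes F :: "'a::euclidean_space \<times> 'a \<Rightarrow> complex"
  assumes F: "F \<in> flat_schwartz"
  shows "integrable lborel (\<lambda>h. (norm h powr a) *\<^sub>R F (x, x + h))"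
proof -
  obtain q :: "('a \<times> 'a \<Rightarrow> complex) \<Rightarrow> real" where q: "\<And>F x h. F \<in> flat_schwartz \<Longrightarrow>
      (1 + norm x) ^ 0 * (norm (F (x, x + h)) * norm h powr a) \<le> q F * (1 / (1 + norm h) ^ (DIM('a) + 2))"
    using controlled_kernel_bound[of 0 a] by blast
  show ?thesis
  proof (rule Bochner_Integration.integrable_bound)
    show "integrable lborel (\<lambda>h::'a. q F * (1 / (1 + norm h) ^ (DIM('a) + 2)))"
      by (intro integrable_mult_right integrable_inverse_power_norm)
    have "norm ((norm h powr a) *\<^sub>R F (x, x + h)) \<le> q F * (1 / (1 + norm h) ^ (DIM('a) + 2))" for h
      using q[OF F, of x h] by (simp add: mult.commute)
    then show "AE h in lborel. norm ((norm h powr a) *\<^sub>R F (x, x + h))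
        \<le> norm (q F * (1 / (1 + norm h) ^ (DIM('a) + 2)))"
      by (intro AE_I2) (metis abs_ge_self order_trans real_norm_def)
  qed (rule measurable_diag_integrand[OF flat_schwartzD(2)[OF F]])
qed

lemma controlled_diag_integral:
  fixes a :: real and k :: nat
  shows "\<exists>q :: ('a::euclidean_space \<times> 'a \<Rightarrow> complex) \<Rightarrow> real. controlled q \<and>
    (\<forall>F\<in>flat_schwartz. \<forall>x. (1 + norm x) ^ k * norm (diag_integral a F x) \<le> q F)"
proof -
  obtain q :: "('a \<times> 'a \<Rightarrow> complex) \<Rightarrow> real" where q: "controlled q" "\<And>F x h. F \<in> flat_schwartz \<Longrightarrow>
      (1 + norm x) ^ k * (norm (F (x, x + h)) * norm h powr a) \<le> q F * (1 / (1 + norm h) ^ (DIM('a) + 2))"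
    using controlled_kernel_bound[of k a] by blast
  define J where "J = (LINT h|lborel. 1 / (1 + norm (h::'a)) ^ (DIM('a) + 2))"
  have J: "0 \<le> J"
    unfolding J_def by (rule integral_nonneg_AE) (auto intro: AE_I2)
  have "(1 + norm x) ^ k * norm (diag_integral a F x) \<le> J * q F" if F: "F \<in> flat_schwartz" for F x
  proof -
    let ?w = "(1 + norm x) ^ k"
    have "norm (LINT h|lborel. ?w *\<^sub>R ((norm h powr a) *\<^sub>R F (x, x + h)))
        \<le> (LINT h|lborel. q F * (1 / (1 + norm (h::'a)) ^ (DIM('a) + 2)))"
    proof (rule Bochner_Integration.integral_norm_bound_integral)
      show "integrable lborel (\<lambda>h. ?w *\<^sub>R ((norm h powr a) *\<^sub>R F (x, x + h)))"
        by (intro integrable_scaleR_right integrable_diag_integrand F)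
      show "integrable lborel (\<lambda>h::'a. q F * (1 / (1 + norm h) ^ (DIM('a) + 2)))"
        by (intro integrable_mult_right integrable_inverse_power_norm)
      show "norm (?w *\<^sub>R ((norm h powr a) *\<^sub>R F (x, x + h))) \<le> q F * (1 / (1 + norm h) ^ (DIM('a) + 2))" for h
        using q(2)[OF F, of x h] by (simp add: mult.commute mult.left_commute)
    qed
    then show ?thesis
      by (simp only: diag_integral_def integral_scaleR_right integral_mult_right_zero J_def norm_scaleR
          abs_of_nonneg mult.commute norm_ge_zero zero_le_power add_nonneg_nonneg zero_le_one)
  qed
  then show ?thesis
    using controlled_scale[OF q(1) J] by blast
qed

lemma diag_integral_diff:
  assumes "F \<in> flat_schwartz" "G \<in> flat_schwartz"
  shows "diag_integral a (\<lambda>z. F z - G z) x = diag_integral a F x - diag_integral a G x"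
  unfolding diag_integral_def scaleR_diff_right
  by (intro Bochner_Integration.integral_diff integrable_diag_integrand assms)

section \<open>Differentiation along the diagonal\<close>

text \<open>
  For smooth \<open>F\<close> this is the derivative in the direction \<open>(b, b)\<close>, which is parallel to the diagonal. It is written as a sum
  of two coordinate derivatives because the seminorms only involve those.
\<close>

definition diag_deriv :: "'a::euclidean_space \<Rightarrow> ('a \<times> 'a \<Rightarrow> complex) \<Rightarrow> 'a \<times> 'a \<Rightarrow> complex" where
  "diag_deriv b F z = partial_deriv (b, 0) F z + partial_deriv (0, b) F z"

lemma Basis_Pair:
  "b \<in> Basis \<Longrightarrow> (b, 0) \<in> Basis" "b \<in> Basis \<Longrightarrow> (0, b) \<in> Basis"
  by (simp_all add: Basis_prod_def)

lemma schwartz_diag_deriv: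
  assumes "F \<in> schwartz_space" "b \<in> Basis"
  shows "diag_deriv b F \<in> schwartz_space"
  unfolding diag_deriv_def[abs_def] by (intro schwartz_add_diff schwartz_partial_deriv Basis_Pair assms)

lemma flat_schwartz_diag_deriv:
  assumes "F \<in> flat_schwartz" "b \<in> Basis"
  shows "diag_deriv b F \<in> flat_schwartz"
  unfolding diag_deriv_def[abs_def]
  by (intro flat_schwartz_add_diff flat_schwartz_partial_deriv Basis_Pair assms)

lemma controlled_diag_deriv:
  assumes q: "controlled q" and b: "b \<in> Basis"
  shows "controlled (\<lambda>F. q (diag_deriv b F))"
proof (rule controlled_compose[OF q schwartz_diag_deriv[OF _ b]])
  fix \<alpha> \<beta> :: "'a \<times> 'a \<Rightarrow> nat"
  show "controlled (\<lambda>F. schwartz_seminorm \<alpha> \<beta> (diag_deriv b F))"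
  proof (rule controlled_mono)
    show "controlled (\<lambda>F. schwartz_seminorm \<alpha> \<beta> (partial_deriv (b, 0) F) +
        schwartz_seminorm \<alpha> \<beta> (partial_deriv (0, b) F))"
      by (intro controlled_add controlled_seminorm_partial_deriv Basis_Pair b)
    show "schwartz_seminorm \<alpha> \<beta> (diag_deriv b F) \<le> schwartz_seminorm \<alpha> \<beta> (partial_deriv (b, 0) F) +
        schwartz_seminorm \<alpha> \<beta> (partial_deriv (0, b) F)" if "F \<in> schwartz_space" for F
      unfolding diag_deriv_def[abs_def]
      by (intro schwartz_seminorm_triangle schwartz_partial_deriv Basis_Pair b that)
  qed
qed

lemma parallel_slice:
  fixes F :: "'a::euclidean_space \<times> 'a \<Rightarrow> complex"
  assumes "smooth F"
  shows "(\<lambda>x. F (x, x + h)) differentiable (at x)"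
    "partial_deriv b (\<lambda>x. F (x, x + h)) x = diag_deriv b F (x, x + h)"
proof -
  obtain D where D: "(F has_derivative D) (at (x, x + h))"
    using smooth_differentiable[OF assms] by (auto simp: differentiable_def)
  then have lin: "linear D"
    by (simp add: has_derivative_def bounded_linear.linear)
  have "((\<lambda>x. (x, x + h)) has_derivative (\<lambda>v. (v, v))) (at x)"
    by (auto intro!: derivative_eq_intros)
  from has_derivative_compose[OF this, of F D] D
  have slice: "((\<lambda>x. F (x, x + h)) has_derivative (\<lambda>v. D (v, v))) (at x)"
    by simp
  then show "(\<lambda>x. F (x, x + h)) differentiable (at x)"
    by (rule differentiableI)
  have "D (b, b) = D (b, 0) + D (0, b)"
    using linear_add[OF lin, of "(b, 0)" "(0, b)"] by simp
  then show "partial_deriv b (\<lambda>x. F (x, x + h)) x = diag_deriv b F (x, x + h)"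
    by (simp add: partial_deriv_eq[OF slice] diag_deriv_def partial_deriv_eq[OF D])
qed

text \<open>
  The remainder of first order in \<open>x\<close> is bounded by second derivatives parallel to the diagonal.
  These are flat on the diagonal again, so the kernel bound applies to them and yields an
  integrable majorant.
\<close>

lemma diag_integrand_taylor:
  fixes F :: "'a::euclidean_space \<times> 'a \<Rightarrow> complex"
  assumes F: "F \<in> flat_schwartz"
  shows "\<exists>C\<ge>0. \<forall>x v h. norm ((norm h powr a) *\<^sub>R (F (x + v, x + v + h) - F (x, x + h)
      - (\<Sum>b\<in>Basis. (v \<bullet> b) *\<^sub>R diag_deriv b F (x, x + h))))
    \<le> (norm v)\<^sup>2 * C * (1 / (1 + norm h) ^ (DIM('a) + 2))"
proof -
  obtain q :: "('a \<times> 'a \<Rightarrow> complex) \<Rightarrow> real" where q: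
    "\<And>F. F \<in> flat_schwartz \<Longrightarrow> 0 \<le> q F"
    "\<And>F x h. F \<in> flat_schwartz \<Longrightarrow>
      (1 + norm x) ^ 0 * (norm (F (x, x + h)) * norm h powr a) \<le> q F * (1 / (1 + norm h) ^ (DIM('a) + 2))"
    using controlled_kernel_bound[of 0 a] by blast
  define Q where "Q = (\<Sum>b\<in>Basis. \<Sum>c\<in>Basis. q (diag_deriv c (diag_deriv b F)))"
  have flat: "diag_deriv c (diag_deriv b F) \<in> flat_schwartz" if "b \<in> Basis" "c \<in> Basis" for b c
    by (intro flat_schwartz_diag_deriv F that)
  have Q: "0 \<le> Q"
    unfolding Q_def by (intro sum_nonneg q flat)
  have le_Q: "q (diag_deriv c (diag_deriv b F)) \<le> Q" if b: "b \<in> Basis" and c: "c \<in> Basis" for b c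
  proof -
    have "q (diag_deriv c (diag_deriv b F)) \<le> (\<Sum>c\<in>Basis. q (diag_deriv c (diag_deriv b F)))"
      using c b by (intro member_le_sum q flat) auto
    also have "\<dots> \<le> Q"
      unfolding Q_def using b by (intro member_le_sum sum_nonneg q flat) auto
    finally show ?thesis .
  qed
  have "norm ((norm h powr a) *\<^sub>R (F (x + v, x + v + h) - F (x, x + h)
      - (\<Sum>b\<in>Basis. (v \<bullet> b) *\<^sub>R diag_deriv b F (x, x + h))))
    \<le> (norm v)\<^sup>2 * ((real DIM('a))\<^sup>2 * Q) * (1 / (1 + norm h) ^ (DIM('a) + 2))" for x v h
  proof (cases "h = 0")
    case True
    then show ?thesis
      using Q by simp
  next
    case False
    \<comment> \<open>The kernel value is positive and constant in \<open>x\<close>, so it can be divided out of the bound on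
      the second derivatives and multiplied back afterwards.\<close>
    let ?\<kappa> = "norm h powr a" and ?f = "\<lambda>x. F (x, x + h)"
    let ?B = "Q * (1 / (1 + norm h) ^ (DIM('a) + 2)) / ?\<kappa>"
    have \<kappa>: "?\<kappa> > 0"
      using False by simp
    have f': "partial_deriv b ?f = (\<lambda>x. diag_deriv b F (x, x + h))" for b
      using parallel_slice(2)[OF flat_schwartzD(2)[OF F]] by blast
    have smooth': "smooth (diag_deriv b F)" if "b \<in> Basis" for b
      by (rule flat_schwartzD(2)[OF flat_schwartz_diag_deriv[OF F that]])
    have "norm (?f (x + v) - ?f x - (\<Sum>b\<in>Basis. (v \<bullet> b) *\<^sub>R partial_deriv b ?f x))
        \<le> (norm v)\<^sup>2 * ((real DIM('a))\<^sup>2 * ?B)"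
    proof (rule taylor_partials)
      show "?f differentiable (at y)" for y
        by (rule parallel_slice(1)[OF flat_schwartzD(2)[OF F]])
      fix b c :: 'a and y assume b: "b \<in> Basis"
      show "partial_deriv b ?f differentiable (at y)"
        unfolding f' by (rule parallel_slice(1)[OF smooth'[OF b]])
      assume c: "c \<in> Basis"
      have "norm (diag_deriv c (diag_deriv b F) (y, y + h)) * ?\<kappa>
          \<le> q (diag_deriv c (diag_deriv b F)) * (1 / (1 + norm h) ^ (DIM('a) + 2))"
        using q(2)[OF flat[OF b c], of y h] by simp
      also have "\<dots> \<le> Q * (1 / (1 + norm h) ^ (DIM('a) + 2))"
        by (intro mult_right_mono le_Q b c) auto
      finally show "norm (partial_deriv c (partial_deriv b ?f) y) \<le> ?B"
        unfolding f' parallel_slice(2)[OF smooth'[OF b]] using \<kappa> by (simp only: pos_le_divide_eq)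
    qed
    then have "?\<kappa> * norm (?f (x + v) - ?f x - (\<Sum>b\<in>Basis. (v \<bullet> b) *\<^sub>R diag_deriv b F (x, x + h)))
        \<le> ?\<kappa> * ((norm v)\<^sup>2 * ((real DIM('a))\<^sup>2 * ?B))"
      unfolding f' by (rule mult_left_mono) simp
    also have "\<dots> = (norm v)\<^sup>2 * ((real DIM('a))\<^sup>2 * Q) * (1 / (1 + norm h) ^ (DIM('a) + 2))"
      using \<kappa> by simp
    finally show ?thesis
      by (simp add: abs_of_pos[OF \<kappa>])
  qed
  then show ?thesis
    using Q by (intro exI[of _ "(real DIM('a))\<^sup>2 * Q"]) auto
qed

lemma has_derivative_quadratic_remainder:
  fixes f :: "'a::euclidean_space \<Rightarrow> 'b::real_normed_vector"
  assumes L: "bounded_linear L"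
    and rem: "\<And>v. norm (f (x + v) - f x - L v) \<le> C * (norm v)\<^sup>2"
  shows "(f has_derivative L) (at x)"
  unfolding has_derivative_at_alt
proof (intro conjI L allI impI)
  fix e :: real assume e: "e > 0"
  have "norm (f y - f x - L (y - x)) \<le> e * norm (y - x)" if y: "norm (y - x) < e / (\<bar>C\<bar> + 1)" for y
  proof -
    have "norm (f y - f x - L (y - x)) \<le> C * (norm (y - x))\<^sup>2"
      using rem[of "y - x"] by simp
    also have "\<dots> \<le> (\<bar>C\<bar> + 1) * norm (y - x) * norm (y - x)"
      unfolding power2_eq_square mult.assoc by (intro mult_right_mono) auto
    also have "\<dots> \<le> e * norm (y - x)"
      by (intro mult_right_mono) (use y in \<open>auto simp: pos_less_divide_eq mult.commute\<close>)
    finally show ?thesis .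
  qed
  then show "\<exists>d>0. \<forall>y. norm (y - x) < d \<longrightarrow> norm (f y - f x - L (y - x)) \<le> e * norm (y - x)"
    using e by (intro exI[of _ "e / (\<bar>C\<bar> + 1)"]) auto
qed

text \<open>
  Integrating the pointwise Taylor estimate over \<open>h\<close> gives a quadratic remainder for the integral.
\<close>

lemma has_derivative_diag_integral:
  fixes F :: "'a::euclidean_space \<times> 'a \<Rightarrow> complex"
  assumes F: "F \<in> flat_schwartz"
  shows "(diag_integral a F has_derivative (\<lambda>v. \<Sum>b\<in>Basis. (v \<bullet> b) *\<^sub>R diag_integral a (diag_deriv b F) x)) (at x)"
proof -
  obtain C where C: "\<And>x v h. norm ((norm h powr a) *\<^sub>R (F (x + v, x + v + h) - F (x, x + h)
      - (\<Sum>b\<in>Basis. (v \<bullet> b) *\<^sub>R diag_deriv b F (x, x + h))))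
    \<le> (norm v)\<^sup>2 * C * (1 / (1 + norm h) ^ (DIM('a) + 2))"
    using diag_integrand_taylor[OF F, of a] by blast
  define J where "J = (LINT h|lborel. 1 / (1 + norm (h::'a)) ^ (DIM('a) + 2))"
  show ?thesis
  proof (rule has_derivative_quadratic_remainder[where C = "C * J"])
    show "bounded_linear (\<lambda>v. \<Sum>b\<in>Basis. (v \<bullet> b) *\<^sub>R diag_integral a (diag_deriv b F) x)"
      by (intro bounded_linear_intros)
    fix v
    let ?\<phi> = "\<lambda>F x h. (norm h powr a) *\<^sub>R F (x, x + h)"
    note int = integrable_diag_integrand[OF F]
      integrable_diag_integrand[OF flat_schwartz_diag_deriv[OF F]]
    have "norm (LINT h|lborel. ?\<phi> F (x + v) h - ?\<phi> F x h - (\<Sum>b\<in>Basis. (v \<bullet> b) *\<^sub>R ?\<phi> (diag_deriv b F) x h))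
        \<le> (LINT h|lborel. (norm v)\<^sup>2 * C * (1 / (1 + norm (h::'a)) ^ (DIM('a) + 2)))"
    proof (rule Bochner_Integration.integral_norm_bound_integral)
      show "integrable lborel (\<lambda>h. ?\<phi> F (x + v) h - ?\<phi> F x h - (\<Sum>b\<in>Basis. (v \<bullet> b) *\<^sub>R ?\<phi> (diag_deriv b F) x h))"
        by (intro Bochner_Integration.integrable_diff Bochner_Integration.integrable_sum
            integrable_scaleR_right int)
      show "integrable lborel (\<lambda>h::'a. (norm v)\<^sup>2 * C * (1 / (1 + norm h) ^ (DIM('a) + 2)))"
        by (intro integrable_mult_right integrable_inverse_power_norm)
      show "norm (?\<phi> F (x + v) h - ?\<phi> F x h - (\<Sum>b\<in>Basis. (v \<bullet> b) *\<^sub>R ?\<phi> (diag_deriv b F) x h))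
          \<le> (norm v)\<^sup>2 * C * (1 / (1 + norm h) ^ (DIM('a) + 2))" for h
        using C[of h x v] unfolding scaleR_diff_right scaleR_sum_right by (simp only: scaleR_left_commute)
    qed
    moreover have "(LINT h|lborel. ?\<phi> F (x + v) h - ?\<phi> F x h - (\<Sum>b\<in>Basis. (v \<bullet> b) *\<^sub>R ?\<phi> (diag_deriv b F) x h))
        = diag_integral a F (x + v) - diag_integral a F x
          - (\<Sum>b\<in>Basis. (v \<bullet> b) *\<^sub>R diag_integral a (diag_deriv b F) x)"
    proof -
      have "(LINT h|lborel. (\<Sum>b\<in>Basis. (v \<bullet> b) *\<^sub>R ?\<phi> (diag_deriv b F) x h))
          = (\<Sum>b\<in>Basis. LINT h|lborel. (v \<bullet> b) *\<^sub>R ?\<phi> (diag_deriv b F) x h)"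
        by (intro Bochner_Integration.integral_sum integrable_scaleR_right int)
      moreover have "integrable lborel (\<lambda>h. \<Sum>b\<in>Basis. (v \<bullet> b) *\<^sub>R ?\<phi> (diag_deriv b F) x h)"
        by (intro Bochner_Integration.integrable_sum integrable_scaleR_right int)
      ultimately show ?thesis
        by (simp only: diag_integral_def Bochner_Integration.integral_diff
            Bochner_Integration.integrable_diff int integral_scaleR_right)
    qed
    ultimately have "norm (diag_integral a F (x + v) - diag_integral a F x
        - (\<Sum>b\<in>Basis. (v \<bullet> b) *\<^sub>R diag_integral a (diag_deriv b F) x)) \<le> (norm v)\<^sup>2 * C * J"
      by (simp only: J_def integral_mult_right_zero)
    then show "norm (diag_integral a F (x + v) - diag_integral a F x
        - (\<Sum>b\<in>Basis. (v \<bullet> b) *\<^sub>R diag_integral a (diag_deriv b F) x)) \<le> C * J * (norm v)\<^sup>2"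
      by (simp only: mult.commute mult.left_commute)
  qed
qed

lemma partial_deriv_diag_integral:
  fixes F :: "'a::euclidean_space \<times> 'a \<Rightarrow> complex"
  assumes "F \<in> flat_schwartz" "b \<in> Basis"
  shows "partial_deriv b (diag_integral a F) = diag_integral a (diag_deriv b F)"
proof
  fix x
  have "(\<Sum>c\<in>Basis. (b \<bullet> c) *\<^sub>R diag_integral a (diag_deriv c F) x) = diag_integral a (diag_deriv b F) x"
    using assms(2) by (simp add: inner_Basis if_distrib[of "\<lambda>r. r *\<^sub>R _"] cong: if_cong)
  then show "partial_deriv b (diag_integral a F) x = diag_integral a (diag_deriv b F) x"
    by (simp add: partial_deriv_eq[OF has_derivative_diag_integral[OF assms(1)]])
qed

lemma smooth_diag_integral:
  assumes "F \<in> flat_schwartz"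
  shows "smooth (diag_integral a F)"
proof -
  have diff: "diag_integral a F differentiable (at x)" if "F \<in> flat_schwartz" for F x
    by (rule differentiableI[OF has_derivative_diag_integral[OF that]])
  have "C_k k (diag_integral a F)" for k
    using assms
  proof (induction k arbitrary: F)
    case 0
    then show ?case
      by (auto intro: continuous_at_imp_continuous_on differentiable_imp_continuous_within diff)
  next
    case (Suc k)
    then show ?case
      by (simp add: diff partial_deriv_diag_integral flat_schwartz_diag_deriv)
  qed
  then show ?thesis
    by (simp add: smooth_def)
qed

lemma flat_schwartz_diag_derivs:
  assumes "F \<in> flat_schwartz" "set bs \<subseteq> Basis"
  shows "foldr diag_deriv bs F \<in> flat_schwartz"
  using assms(2) by (induction bs) (auto simp: assms(1) flat_schwartz_diag_deriv)

text \<open>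
  Every derivative of the integral is the integral of a function of the same class. Hence all
  Schwartz bounds reduce to the undifferentiated estimate \<open>controlled_diag_integral\<close>.
\<close>

lemma derivs_diag_integral:
  assumes "F \<in> flat_schwartz" "set bs \<subseteq> Basis"
  shows "derivs bs (diag_integral a F) = diag_integral a (foldr diag_deriv bs F)"
  using assms(2)
  by (induction bs) (auto simp: partial_deriv_diag_integral flat_schwartz_diag_derivs assms(1))

lemma controlled_derivs_diag_integral:
  fixes bs :: "'a::euclidean_space list"
  assumes bs: "set bs \<subseteq> Basis"
  shows "\<exists>q. controlled q \<and>
    (\<forall>F\<in>flat_schwartz. \<forall>x. (1 + norm x) ^ k * norm (derivs bs (diag_integral a F) x) \<le> q F)"
proof -
  obtain q :: "('a \<times> 'a \<Rightarrow> complex) \<Rightarrow> real" where q: "controlled q"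
    "\<And>F x. F \<in> flat_schwartz \<Longrightarrow> (1 + norm x) ^ k * norm (diag_integral a F x) \<le> q F"
    using controlled_diag_integral[of k a] by blast
  have "controlled (\<lambda>F. q (foldr diag_deriv bs F))"
    using bs q(1)
  proof (induction bs arbitrary: q)
    case (Cons b bs)
    have "controlled (\<lambda>F. q (diag_deriv b F))"
      by (rule controlled_diag_deriv) (use Cons.prems in auto)
    from Cons.IH[OF _ this] show ?case
      using Cons.prems by simp
  qed simp
  then show ?thesis
    using q(2)[OF flat_schwartz_diag_derivs[OF _ bs]] derivs_diag_integral[OF _ bs]
    by (intro exI[of _ "\<lambda>F. q (foldr diag_deriv bs F)"]) auto
qed

lemma schwartz_diag_integral:
  assumes "F \<in> flat_schwartz"
  shows "diag_integral a F \<in> schwartz_space"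
  unfolding schwartz_space_iff_weighted
  using assms smooth_diag_integral controlled_derivs_diag_integral by blast

lemma controlled_seminorm_diag_integral:
  fixes \<alpha> \<beta> :: "'a::euclidean_space \<Rightarrow> nat"
  shows "\<exists>q. controlled q \<and> (\<forall>F\<in>flat_schwartz. schwartz_seminorm \<alpha> \<beta> (diag_integral a F) \<le> q F)"
proof -
  obtain q :: "('a \<times> 'a \<Rightarrow> complex) \<Rightarrow> real" where q: "controlled q"
    "\<And>F x. F \<in> flat_schwartz \<Longrightarrow>
      (1 + norm x) ^ (\<Sum>b\<in>Basis. \<alpha> b) * norm (multi_deriv \<beta> (diag_integral a F) x) \<le> q F"
    unfolding multi_deriv_eq_derivs
    using controlled_derivs_diag_integral[OF set_index_list, of "\<Sum>b\<in>Basis. \<alpha> b" \<beta> a] by blast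
  have "schwartz_seminorm \<alpha> \<beta> (diag_integral a F) \<le> q F" if "F \<in> flat_schwartz" for F
    by (rule schwartz_seminorm_least)
      (rule order_trans[OF mult_right_mono[OF abs_monomial_le norm_ge_zero] q(2)[OF that]])
  with q(1) show ?thesis
    by blast
qed

section \<open>Off-diagonal Schwartz functions and the s-divergence\<close>

lemma derivs_slice_snd: "derivs bs (\<lambda>y. G (x, y)) = (\<lambda>y. derivs (map (Pair 0) bs) G (x, y))"
  by (induction bs) (simp_all add: partial_deriv_def fun_eq_iff)

lemma derivs_slice_fst: "derivs bs (\<lambda>x. G (x, y)) = (\<lambda>x. derivs (map (\<lambda>b. (b, 0)) bs) G (x, y))"
  by (induction bs) (simp_all add: partial_deriv_def fun_eq_iff)

lemma count_mset_map_inj: "inj f \<Longrightarrow> count (mset (map f xs)) (f x) = count (mset xs) x"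
  by (induction xs) (auto simp: inj_eq)

text \<open>
  The coordinate directions of the product are those of the two factors, so a list of them can be
  sorted into directions of the first factor followed by directions of the second.
\<close>

lemma mset_product_index_list:
  fixes bs :: "('a::euclidean_space \<times> 'b::euclidean_space) list"
  assumes bs: "set bs \<subseteq> Basis"
  shows "mset bs = mset (map (\<lambda>b. (b, 0)) (index_list (\<lambda>b. count (mset bs) (b, 0)))
    @ map (Pair 0) (index_list (\<lambda>b. count (mset bs) (0, b))))"
proof -
  have inj: "inj (\<lambda>b::'a. (b, 0::'b))" "inj (Pair (0::'a) :: 'b \<Rightarrow> _)"
    by (auto intro: injI)
  have fst0: "count (mset (map (Pair 0) (index_list \<beta>))) (b, 0) = 0" if "b \<in> Basis" for b :: 'a and \<beta> :: "'b \<Rightarrow> nat"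
    using that by (auto simp: count_eq_zero_iff)
  have snd0: "count (mset (map (\<lambda>b. (b, 0)) (index_list \<alpha>))) (0, b) = 0" if "b \<in> Basis" for b :: 'b and \<alpha> :: "'a \<Rightarrow> nat"
    using that by (auto simp: count_eq_zero_iff)
  show ?thesis
  proof (rule multiset_eqI)
    fix e :: "'a \<times> 'b"
    consider (fst) b where "e = (b, 0)" "b \<in> Basis" | (snd) b where "e = (0, b)" "b \<in> Basis" | (none) "e \<notin> Basis"
      by (auto simp: Basis_prod_def)
    then show "count (mset bs) e = count (mset (map (\<lambda>b. (b, 0)) (index_list (\<lambda>b. count (mset bs) (b, 0)))
        @ map (Pair 0) (index_list (\<lambda>b. count (mset bs) (0, b))))) e"
    proof cases
      case fst
      then show ?thesis
        using count_mset_map_inj[OF inj(1), of "index_list (\<lambda>b. count (mset bs) (b, 0))" b] fst0[OF fst(2)]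
        by (simp add: count_index_list del: mset_map)
    next
      case snd
      then show ?thesis
        using count_mset_map_inj[OF inj(2), of "index_list (\<lambda>b. count (mset bs) (0, b))" b] snd0[OF snd(2)]
        by (simp add: count_index_list del: mset_map)
    next
      case none
      have zero: "count (mset xs) e = 0" if "set xs \<subseteq> Basis" for xs
        using none that by (auto simp: count_eq_zero_iff)
      have "set (map (\<lambda>b. (b, 0)) (index_list (\<lambda>b. count (mset bs) (b, 0)))
          @ map (Pair 0) (index_list (\<lambda>b. count (mset bs) (0, b)))) \<subseteq> Basis"
        by (auto simp: Basis_prod_def dest: subsetD[OF set_index_list])
      from zero[OF bs] zero[OF this] show ?thesis
        by (simp only:)
    qed
  qed
qed

text \<open>
  The defining condition takes all \<open>y\<close>-derivatives before all \<open>x\<close>-derivatives and each in the order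
  of its own basis. By symmetry of mixed derivatives this covers every order.
\<close>

lemma schwartz_od_subset_flat: "schwartz_od \<subseteq> flat_schwartz"
proof
  fix G :: "(real ^ 'n) \<times> (real ^ 'n) \<Rightarrow> complex"
  assume G: "G \<in> schwartz_od"
  then have schwartz: "G \<in> schwartz_space"
    and vanish: "\<And>\<alpha> \<beta> z. multi_deriv \<alpha> (\<lambda>x. multi_deriv \<beta> (\<lambda>y. G (x, y)) z) z = 0"
    unfolding schwartz_od_def by blast+
  have "derivs bs G (z, z) = 0" if bs: "set bs \<subseteq> Basis" for bs z
  proof -
    let ?\<alpha> = "\<lambda>b. count (mset bs) (b, 0)" and ?\<beta> = "\<lambda>b. count (mset bs) (0, b)"
    have "derivs bs G (z, z) = derivs (map (\<lambda>b. (b, 0)) (index_list ?\<alpha>) @ map (Pair 0) (index_list ?\<beta>)) G (z, z)"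
      by (subst derivs_cong_mset[OF schwartz_smooth[OF schwartz] bs mset_product_index_list[OF bs]]) simp
    also have "\<dots> = multi_deriv ?\<alpha> (\<lambda>x. multi_deriv ?\<beta> (\<lambda>y. G (x, y)) z) z"
      unfolding multi_deriv_eq_derivs derivs_slice_snd derivs_slice_fst by simp
    finally show ?thesis
      using vanish by simp
  qed
  with schwartz show "G \<in> flat_schwartz"
    by (simp add: flat_schwartz_def)
qed

lemma lborel_translate:
  fixes f :: "'a::euclidean_space \<Rightarrow> complex"
  assumes "f \<in> borel_measurable borel"
  shows "integrable lborel f \<longleftrightarrow> integrable lborel (\<lambda>h. f (x + h))"
    "(LINT y|lborel. f y) = (LINT h|lborel. f (x + h))"
proof -
  have *: "lborel = distr lborel borel ((+) x)"
    by (rule lborel_distr_plus[symmetric])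
  show "integrable lborel f \<longleftrightarrow> integrable lborel (\<lambda>h. f (x + h))"
    by (subst *, rule integrable_distr_eq) (use assms in simp_all)
  show "(LINT y|lborel. f y) = (LINT h|lborel. f (x + h))"
    by (subst *, rule integral_distr) (use assms in simp_all)
qed

text \<open>
  The equation also holds at \<open>h = 0\<close>, where both sides vanish by the conventions for division and
  powers of \<open>0\<close>.
\<close>

lemma div_integrand_translate:
  fixes G :: "(real ^ 'n) \<times> (real ^ 'n) \<Rightarrow> complex"
  shows "div_integrand s G x (x + h) = (norm h powr (- (s + CARD('n)))) *\<^sub>R G (x, x + h)
    + (norm h powr (- (s + CARD('n)))) *\<^sub>R G (x, x + h)"
proof (cases "h = 0")
  case False
  have "norm h powr (- (s + CARD('n))) = 1 / (norm h powr s * norm h ^ CARD('n))"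
    unfolding powr_minus powr_add using False by (simp add: powr_realpow inverse_eq_divide)
  then show ?thesis
    unfolding div_integrand_def by (simp only:) (simp add: scaleR_conv_of_real)
qed (simp add: div_integrand_def)

lemma measurable_div_integrand:
  fixes G :: "(real ^ 'n) \<times> (real ^ 'n) \<Rightarrow> complex"
  assumes "smooth G"
  shows "div_integrand s G x \<in> borel_measurable borel"
proof -
  have "continuous_on UNIV (\<lambda>y. G (x, y))"
    by (rule continuous_on_compose2[OF smooth_continuous_on[OF assms, of UNIV]])
      (auto intro!: continuous_intros)
  then have [measurable]: "(\<lambda>y. G (x, y)) \<in> borel_measurable borel"
    by (rule borel_measurable_continuous_onI)
  show ?thesis
    unfolding div_integrand_def[abs_def] by measurable
qed

lemma s_div_eq_diag_integral:
  fixes G :: "(real ^ 'n) \<times> (real ^ 'n) \<Rightarrow> complex"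
  assumes G: "G \<in> flat_schwartz"
  shows "integrable lborel (div_integrand s G x)"
    "s_div s G = (\<lambda>x. diag_integral (- (s + CARD('n))) G x + diag_integral (- (s + CARD('n))) G x)"
proof -
  note meas = measurable_div_integrand[OF flat_schwartzD(2)[OF G], of s]
  note int = integrable_diag_integrand[OF G]
  show "integrable lborel (div_integrand s G x)"
    unfolding lborel_translate(1)[OF meas, of x x] div_integrand_translate
    by (intro Bochner_Integration.integrable_add int)
  show "s_div s G = (\<lambda>x. diag_integral (- (s + CARD('n))) G x + diag_integral (- (s + CARD('n))) G x)"
  proof
    fix x
    show "s_div s G x = diag_integral (- (s + CARD('n))) G x + diag_integral (- (s + CARD('n))) G x"
      unfolding s_div_def diag_integral_def lborel_translate(2)[OF meas, of x x] div_integrand_translate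
      by (intro Bochner_Integration.integral_add int)
  qed
qed

lemma schwartz_s_div:
  fixes G :: "(real ^ 'n) \<times> (real ^ 'n) \<Rightarrow> complex"
  assumes "G \<in> flat_schwartz"
  shows "s_div s G \<in> schwartz_space"
  unfolding s_div_eq_diag_integral(2)[OF assms]
  by (intro schwartz_add_diff schwartz_diag_integral assms)

lemma continuous_map_s_div:
  "continuous_map (subtopology schwartz_topology flat_schwartz) schwartz_topology
    (s_div s :: ((real ^ 'n) \<times> (real ^ 'n) \<Rightarrow> complex) \<Rightarrow> _)"
proof (rule continuous_map_schwartz)
  show "(flat_schwartz :: ((real ^ 'n) \<times> (real ^ 'n) \<Rightarrow> complex) set) \<subseteq> schwartz_space"
    by (auto intro: flat_schwartzD)
  fix F G :: "(real ^ 'n) \<times> (real ^ 'n) \<Rightarrow> complex"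
  assume F: "F \<in> flat_schwartz"
  show "s_div s F \<in> schwartz_space"
    by (rule schwartz_s_div[OF F])
  assume G: "G \<in> flat_schwartz"
  show diff: "(\<lambda>x. F x - G x) \<in> flat_schwartz"
    by (rule flat_schwartz_add_diff(2)[OF F G])
  show "s_div s (\<lambda>x. F x - G x) = (\<lambda>x. s_div s F x - s_div s G x)"
    by (simp add: s_div_eq_diag_integral(2) diff F G diag_integral_diff)
next
  let ?a = "- (s + CARD('n))"
  fix \<alpha> \<beta> :: "real ^ 'n \<Rightarrow> nat"
  obtain q :: "((real ^ 'n) \<times> (real ^ 'n) \<Rightarrow> complex) \<Rightarrow> real" where q: "controlled q"
      "\<And>F. F \<in> flat_schwartz \<Longrightarrow> schwartz_seminorm \<alpha> \<beta> (diag_integral ?a F) \<le> q F"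
    using controlled_seminorm_diag_integral[of \<alpha> \<beta> ?a] by blast
  have "schwartz_seminorm \<alpha> \<beta> (s_div s F) \<le> q F + q F" if F: "F \<in> flat_schwartz" for F
    unfolding s_div_eq_diag_integral(2)[OF F]
    by (rule order_trans[OF schwartz_seminorm_triangle add_mono[OF q(2)[OF F] q(2)[OF F]]])
      (rule schwartz_diag_integral[OF F])+
  then show "\<exists>q. controlled q \<and> (\<forall>F\<in>flat_schwartz. schwartz_seminorm \<alpha> \<beta> (s_div s F) \<le> q F)"
    using controlled_add[OF q(1) q(1)] by blast
qed

theorem lemma3p3:
  shows "(\<forall>(G :: (real ^ 'n) \<times> (real ^ 'n) \<Rightarrow> complex) \<in> schwartz_od. \<forall>s :: real.
            (\<forall>x. integrable lborel (div_integrand s G x)) \<and>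
            (\<forall>x. s_div s G x =
              (LINT y|lborel. (G (x, y) - G (y, x)) / complex_of_real (norm (x - y) powr s)
                * complex_of_real (1 / norm (x - y) ^ CARD('n)))) \<and>
            s_div s G \<in> schwartz_space) \<and>
         (\<forall>s :: real. continuous_map
            (schwartz_od_topology :: ((real ^ 'n) \<times> (real ^ 'n) \<Rightarrow> complex) topology)
            schwartz_topology (s_div s))"
proof (intro conjI ballI allI)
  fix G :: "(real ^ 'n) \<times> (real ^ 'n) \<Rightarrow> complex" and s :: real and x :: "real ^ 'n"
  assume G: "G \<in> schwartz_od"
  then have flat: "G \<in> flat_schwartz"
    using schwartz_od_subset_flat by blast
  show "integrable lborel (div_integrand s G x)"
    by (rule s_div_eq_diag_integral(1)[OF flat])
  show "s_div s G \<in> schwartz_space"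
    by (rule schwartz_s_div[OF flat])
  have "G (x, y) - G (y, x) = 2 * G (x, y)" for x y
  proof -
    have "G (y, x) = - G (x, y)"
      using G unfolding schwartz_od_def by blast
    then show ?thesis
      by simp
  qed
  then show "s_div s G x = (LINT y|lborel. (G (x, y) - G (y, x)) / complex_of_real (norm (x - y) powr s)
      * complex_of_real (1 / norm (x - y) ^ CARD('n)))"
    by (simp only: s_div_def div_integrand_def)
next
  fix s :: real
  show "continuous_map (schwartz_od_topology :: ((real ^ 'n) \<times> (real ^ 'n) \<Rightarrow> complex) topology)
      schwartz_topology (s_div s)"
    unfolding schwartz_od_topology_def
    by (rule continuous_map_from_subtopology_mono[OF continuous_map_s_div schwartz_od_subset_flat])
qed

end
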